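(* Let $I,J\subseteq\{1,\dots,n\}$ with $|I|=|J|$ be such that the minor $M_I^J(\lambda)$ of the characteristic matrix $\Phi_{\mathcal L}-\lambda E$ is extremal. Then its highest coefficient $P_I^J\in S(\mathcal L)=K[\mathcal L^*]$ is invariant with respect to the adjoint representation of the group $N$ in $S(\mathcal L)$ (respectively, the coadjoint representation of $N$ in $K[\mathcal L^*]$).
   Context: Let $K$ be a field of characteristic zero, $N=\mathrm{UT}(n,K)$ the group of lower triangular $n\times n$ matrices over $K$ with units on the diagonal, and $\mathfrak n$ its Lie algebra of strictly lower triangular matrices with standard basis of matrix units $y_{ij}$, $(i,j)\in\Delta_+=\{(i,j): n\ge i>j\ge 1\}$. Let $M\subseteq\Delta_+$ be a subset such that whenever $(i,j),(j,m)\in\Delta_+$ and at least one of them lies in $M$, then $(i,m)\in M$. Then $\mathfrak m=\mathrm{span}\{y_\eta:\eta\in M\}$ is an ideal of $\mathfrak n$ (a regular ideal). Put $\mathcal L=\mathfrak n/\mathfrak m$ and let $L=N/\exp(\mathfrak m)$ be the corresponding factor group. $N$ acts (through $L$) on $\mathcal L$ by the adjoint representation, hence on the symmetric algebra $S(\mathcal L)$, and on $\mathcal L^*$ by the coadjoint representation $\mathrm{Ad}^*_g f(x)=f(\mathrm{Ad}_g^{-1}x)$, hence on the algebra $K[\mathcal L^*]$ of regular functions; $S(\mathcal L)$ is identified with $K[\mathcal L^*]$. $\Phi_{\mathcal L}$ is the formal $n\times n$ matrix with entries in $S(\mathcal L)$ whose $(i,j)$ entry is $y_{ij}$ if $(i,j)\in\Delta_+\setminus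 M$ and $0$ otherwise (on and above the diagonal and on the places of $M$). Let $\lambda$ be a variable, $E$ the identity matrix. For $I,J\subseteq\{1,\dots,n\}$ with $|I|=|J|$, $M_I^J(\lambda)\in S(\mathcal L)[\lambda]$ denotes the minor of $\Phi_{\mathcal L}-\lambda E$ with system of rows $I$ and system of columns $J$; if it is nonzero, $P_I^J\in S(\mathcal L)$ denotes its highest coefficient as a polynomial in $\lambda$. For a minor $M(\lambda)=M_I^J(\lambda)$ and $1\le i<n$ put: $M^{\downarrow}(\lambda)=M_{(I\setminus\{i\})\cup\{i+1\}}^J(\lambda)$ if $i\in I$ and $i+1\notin I$, and $M^{\downarrow}(\lambda)=0$ otherwise; $M^{\leftarrow}(\lambda)=M_I^{(J\setminus\{i+1\})\cup\{i\}}(\lambda)$ if $i+1\in J$ and $i\notin J$, and $M^{\leftarrow}(\lambda)=0$ otherwise. A nonzero minor $M(\lambda)=M_I^J(\lambda)$ is called extremal if for every $i$, $1\le i<n$, $\deg M^{\leftarrow}(\lambda)<\deg M(\lambda)$ and $\deg M^{\downarrow}(\lambda)<\deg M(\lambda)$, where degrees are in $\lambda$ and the inequalities are considered true when $M^{\leftarrow}(\lambda)=0$, respectively $M^{\downarrow}(\lambda)=0$. *)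

theory Defs
  imports
    "HOL-Library.Poly_Mapping"
    "HOL-Library.FuncSet"
    "HOL-Algebra.Group"
    "Jordan_Normal_Form.Determinant"
    "Jordan_Normal_Form.DL_Submatrix"
begin

(* Rows and columns are numbered 0, ..., n - 1, as everywhere in Jordan_Normal_Form, so all the
   usual indices 1, ..., n are shifted down by one. *)

section \<open>The group of unitriangular matrices\<close>

definition UT :: "nat \<Rightarrow> 'a::field_char_0 mat monoid" where
  "UT n = \<lparr>carrier = {g \<in> carrier_mat n n.
              (\<forall>i<n. g $$ (i, i) = 1) \<and> (\<forall>i<n. \<forall>j<n. i < j \<longrightarrow> g $$ (i, j) = 0)},
           mult = (*), one = 1\<^sub>m n\<rparr>"

lemma carrier_UT:
  "g \<in> carrier (UT n) \<longleftrightarrow> g \<in> carrier_mat n n \<and>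
     (\<forall>i<n. g $$ (i, i) = 1) \<and> (\<forall>i<n. \<forall>j<n. i < j \<longrightarrow> g $$ (i, j) = 0)"
  by (auto simp: UT_def)

lemma mult_UT [simp]: "mult (UT n) = (*)"
  by (simp add: UT_def)

lemma one_UT [simp]: "one (UT n) = 1\<^sub>m n"
  by (simp add: UT_def)

lemma index_mult_sum:
  assumes "A \<in> carrier_mat n n" "B \<in> carrier_mat n n" "i < n" "j < n"
  shows "(A * B) $$ (i, j) = (\<Sum>k<n. A $$ (i, k) * B $$ (k, j))"
  using assms by (auto simp: scalar_prod_def lessThan_atLeast0 intro!: sum.cong)

lemma UT_mult_row:
  assumes g: "g \<in> carrier (UT n)" and B: "B \<in> carrier_mat n n" and ij: "i < n" "j < n"
  shows "(g * B) $$ (i, j) = B $$ (i, j) + (\<Sum>k<i. g $$ (i, k) * B $$ (k, j))"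
proof -
  have "(g * B) $$ (i, j) = (\<Sum>k<n. g $$ (i, k) * B $$ (k, j))"
    using g B ij by (intro index_mult_sum) (auto simp: carrier_UT)
  also have "\<dots> = (\<Sum>k\<in>insert i {..<i}. g $$ (i, k) * B $$ (k, j))"
    using g ij by (intro sum.mono_neutral_right) (auto simp: carrier_UT)
  finally show ?thesis using g ij by (simp add: carrier_UT)
qed

lemma UT_right_inverse:
  assumes g: "g \<in> carrier (UT n)" and h: "h \<in> carrier_mat n n" and gh: "g * h = 1\<^sub>m n"
  shows "h \<in> carrier (UT n)"
proof -
  have eq: "h $$ (i, j) + (\<Sum>k<i. g $$ (i, k) * h $$ (k, j)) = (if i = j then 1 else 0)"
    if "i < n" "j < n" for i j
    using UT_mult_row[OF g h that] gh that by simp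
  have upper: "h $$ (i, j) = 0" if "i < j" "j < n" for i j
    using that
  proof (induction i rule: less_induct)
    case (less i)
    then have "(\<Sum>k<i. g $$ (i, k) * h $$ (k, j)) = 0"
      by (intro sum.neutral) auto
    then show ?case using eq[of i j] less.prems by simp
  qed
  have "h $$ (i, i) = 1" if "i < n" for i
  proof -
    have "(\<Sum>k<i. g $$ (i, k) * h $$ (k, i)) = 0"
      using upper that by (intro sum.neutral) auto
    then show ?thesis using eq[of i i] that by simp
  qed
  then show ?thesis using upper h by (simp add: carrier_UT)
qed

lemma group_UT: "group (UT n)"
proof (rule groupI)
  fix g h :: "'a mat" assume g: "g \<in> carrier (UT n)" and h: "h \<in> carrier (UT n)"
  have hc: "h \<in> carrier_mat n n" using h by (simp add: carrier_UT)
  have "(g * h) $$ (i, j) = (if i = j then 1 else 0)" if "i \<le> j" "j < n" for i j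
  proof -
    have "(\<Sum>k<i. g $$ (i, k) * h $$ (k, j)) = 0"
      using h that by (intro sum.neutral) (auto simp: carrier_UT)
    then show ?thesis using UT_mult_row[OF g hc, of i j] h that by (simp add: carrier_UT)
  qed
  then show "g \<otimes>\<^bsub>UT n\<^esub> h \<in> carrier (UT n)"
    using g h mult_carrier_mat[of g n n h n] by (simp add: carrier_UT)
next
  show "\<one>\<^bsub>UT n\<^esub> \<in> carrier (UT n)" by (simp add: carrier_UT)
next
  fix g :: "'a mat" assume g: "g \<in> carrier (UT n)"
  then have gc: "g \<in> carrier_mat n n" by (simp add: carrier_UT)
  show "\<one>\<^bsub>UT n\<^esub> \<otimes>\<^bsub>UT n\<^esub> g = g" using gc by simp
  have "det g = prod_list (diag_mat g)"
    using g by (intro det_lower_triangular[OF _ gc]) (auto simp: carrier_UT)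
  also have "\<dots> = 1"
    using g by (auto simp: prod_list_diag_prod carrier_UT)
  finally have "g \<in> Units (ring_mat TYPE('a) n ())"
    by (intro det_non_zero_imp_unit[OF gc]) simp
  then obtain h where h: "h \<in> carrier_mat n n" "h * g = 1\<^sub>m n" "g * h = 1\<^sub>m n"
    unfolding Units_def by (auto simp: ring_mat_simps)
  then show "\<exists>h\<in>carrier (UT n). h \<otimes>\<^bsub>UT n\<^esub> g = \<one>\<^bsub>UT n\<^esub>"
    using UT_right_inverse[OF g] by auto
qed (auto simp: carrier_UT intro!: assoc_mult_mat)

section \<open>Regular ideals and the factor algebra\<close>

definition pos_roots :: "nat \<Rightarrow> (nat \<times> nat) set" where
  "pos_roots n = {(i, j). j < i \<and> i < n}"

definition regular_subset :: "nat \<Rightarrow> (nat \<times> nat) set \<Rightarrow> bool" where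
  "regular_subset n M \<longleftrightarrow> M \<subseteq> pos_roots n \<and>
     (\<forall>i j m. (i, j) \<in> pos_roots n \<longrightarrow> (j, m) \<in> pos_roots n \<longrightarrow>
        (i, j) \<in> M \<or> (j, m) \<in> M \<longrightarrow> (i, m) \<in> M)"

definition matrix_unit :: "nat \<Rightarrow> nat \<times> nat \<Rightarrow> 'a::field_char_0 mat" where
  "matrix_unit n \<eta> = mat n n (\<lambda>\<mu>. if \<mu> = \<eta> then 1 else 0)"

definition nil_alg :: "nat \<Rightarrow> 'a::field_char_0 mat set" where
  "nil_alg n = {X \<in> carrier_mat n n. \<forall>i<n. \<forall>j<n. i \<le> j \<longrightarrow> X $$ (i, j) = 0}"

(* The matrix on the right is the linear combination of the matrix units at the places \<eta> \<in> M
   with coefficients c \<eta>. *)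
definition reg_ideal :: "nat \<Rightarrow> (nat \<times> nat) set \<Rightarrow> 'a::field_char_0 mat set" where
  "reg_ideal n M = {mat n n (\<lambda>\<eta>. if \<eta> \<in> M then c \<eta> else 0) | c. True}"

definition factor_coset :: "nat \<Rightarrow> (nat \<times> nat) set \<Rightarrow> 'a::field_char_0 mat \<Rightarrow> 'a mat set" where
  "factor_coset n M X = {X + Z | Z. Z \<in> reg_ideal n M}"

definition factor_alg :: "nat \<Rightarrow> (nat \<times> nat) set \<Rightarrow> 'a::field_char_0 mat set set" where
  "factor_alg n M = factor_coset n M ` nil_alg n"

definition Ad :: "nat \<Rightarrow> 'a::field_char_0 mat \<Rightarrow> 'a mat set \<Rightarrow> 'a mat set" where
  "Ad n g C = (\<lambda>X. g * X * inv\<^bsub>UT n\<^esub> g) ` C"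

lemma reg_ideal_iff:
  "X \<in> reg_ideal n M \<longleftrightarrow>
     X \<in> carrier_mat n n \<and> (\<forall>i<n. \<forall>j<n. (i, j) \<notin> M \<longrightarrow> X $$ (i, j) = 0)"
proof
  assume X: "X \<in> carrier_mat n n \<and> (\<forall>i<n. \<forall>j<n. (i, j) \<notin> M \<longrightarrow> X $$ (i, j) = 0)"
  then have "X = mat n n (\<lambda>\<eta>. if \<eta> \<in> M then X $$ \<eta> else 0)"
    by (intro eq_matI) auto
  then show "X \<in> reg_ideal n M" unfolding reg_ideal_def by blast
qed (auto simp: reg_ideal_def)

lemma nil_alg_eq_reg_ideal: "nil_alg n = reg_ideal n (pos_roots n)"
  by (auto simp: nil_alg_def reg_ideal_iff pos_roots_def not_le)

lemma regular_subset_pos_roots: "regular_subset n (pos_roots n)"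
  by (auto simp: regular_subset_def pos_roots_def)

lemma reg_ideal_mult_left:
  assumes M: "regular_subset n M" and g: "g \<in> carrier (UT n) \<or> g \<in> nil_alg n"
    and X: "X \<in> reg_ideal n M"
  shows "g * X \<in> reg_ideal n M"
proof -
  have gc: "g \<in> carrier_mat n n" using g by (auto simp: carrier_UT nil_alg_def)
  have Xc: "X \<in> carrier_mat n n" using X by (simp add: reg_ideal_iff)
  have "g $$ (i, k) * X $$ (k, j) = 0" if "i < n" "j < n" "(i, j) \<notin> M" "k < n" for i j k
  proof (cases "(k, j) \<in> M \<and> k < i")
    case True
    then have "(i, k) \<in> pos_roots n" "(k, j) \<in> pos_roots n"
      using M that by (auto simp: regular_subset_def pos_roots_def)
    then have "(i, j) \<in> M" using M True by (auto simp: regular_subset_def)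
    then show ?thesis using that by simp
  next
    case False
    then consider "(k, j) \<notin> M" | "i < k" | "i = k" by linarith
    then show ?thesis
      using that g X by cases (auto simp: carrier_UT nil_alg_def reg_ideal_iff)
  qed
  then show ?thesis using gc Xc by (auto simp: reg_ideal_iff index_mult_sum simp del: index_mult_mat intro!: sum.neutral)
qed

lemma reg_ideal_mult_right:
  assumes M: "regular_subset n M" and g: "g \<in> carrier (UT n) \<or> g \<in> nil_alg n"
    and X: "X \<in> reg_ideal n M"
  shows "X * g \<in> reg_ideal n M"
proof -
  have gc: "g \<in> carrier_mat n n" using g by (auto simp: carrier_UT nil_alg_def)
  have Xc: "X \<in> carrier_mat n n" using X by (simp add: reg_ideal_iff)
  have "X $$ (i, k) * g $$ (k, j) = 0" if "i < n" "j < n" "(i, j) \<notin> M" "k < n" for i j k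
  proof (cases "(i, k) \<in> M \<and> j < k")
    case True
    then have "(i, k) \<in> pos_roots n" "(k, j) \<in> pos_roots n"
      using M that by (auto simp: regular_subset_def pos_roots_def)
    then have "(i, j) \<in> M" using M True by (auto simp: regular_subset_def)
    then show ?thesis using that by simp
  next
    case False
    then consider "(i, k) \<notin> M" | "k < j" | "j = k" by linarith
    then show ?thesis
      using that g X by cases (auto simp: carrier_UT nil_alg_def reg_ideal_iff)
  qed
  then show ?thesis using gc Xc by (auto simp: reg_ideal_iff index_mult_sum simp del: index_mult_mat intro!: sum.neutral)
qed

lemma conj_reg_ideal:
  assumes "regular_subset n M" and g: "g \<in> carrier (UT n)" and "X \<in> reg_ideal n M"
  shows "g * X * inv\<^bsub>UT n\<^esub> g \<in> reg_ideal n M"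
  using assms group.inv_closed[OF group_UT g]
  by (blast intro: reg_ideal_mult_left reg_ideal_mult_right)

lemma conj_nil_alg:
  assumes "g \<in> carrier (UT n)" and "X \<in> nil_alg n"
  shows "g * X * inv\<^bsub>UT n\<^esub> g \<in> nil_alg n"
  using conj_reg_ideal[OF regular_subset_pos_roots] assms by (simp add: nil_alg_eq_reg_ideal)

lemma Ad_factor_coset:
  assumes M: "regular_subset n M" and g: "g \<in> carrier (UT n)" and X: "X \<in> nil_alg n"
  shows "Ad n g (factor_coset n M X) = factor_coset n M (g * X * inv\<^bsub>UT n\<^esub> g)"
proof -
  let ?h = "inv\<^bsub>UT n\<^esub> g"
  have h: "?h \<in> carrier (UT n)" using g by (rule group.inv_closed[OF group_UT])
  have c: "g \<in> carrier_mat n n" "?h \<in> carrier_mat n n" "X \<in> carrier_mat n n"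
    using g h X by (auto simp: carrier_UT nil_alg_def)
  have gh: "g * ?h = 1\<^sub>m n" using group.r_inv[OF group_UT g] by simp
  have conj_add: "g * (X + Z) * ?h = g * X * ?h + g * Z * ?h" if "Z \<in> carrier_mat n n" for Z
    using c that
    by (simp add: mult_add_distrib_mat[of _ n n _ n] add_mult_distrib_mat[of _ n n _ _ n])
  have conj_inv: "Z = g * (?h * Z * g) * ?h" if Z: "Z \<in> carrier_mat n n" for Z
  proof -
    have "g * (?h * Z * g) * ?h = (g * ?h) * Z * (g * ?h)"
      using c Z by (simp add: assoc_mult_mat[of _ n n _ n _ n])
    then show ?thesis using gh Z by simp
  qed
  have surj: "?h * Z * g \<in> reg_ideal n M" if "Z \<in> reg_ideal n M" for Z
    using that M g h by (blast intro: reg_ideal_mult_left reg_ideal_mult_right)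
  show ?thesis
  proof (intro equalityI subsetI)
    fix Y assume "Y \<in> Ad n g (factor_coset n M X)"
    then obtain Z where Z: "Z \<in> reg_ideal n M" "Y = g * (X + Z) * ?h"
      by (auto simp: Ad_def factor_coset_def)
    then have "Y = g * X * ?h + g * Z * ?h" using conj_add by (auto simp: reg_ideal_iff)
    then show "Y \<in> factor_coset n M (g * X * ?h)"
      using conj_reg_ideal[OF M g Z(1)] by (auto simp: factor_coset_def)
  next
    fix Y assume "Y \<in> factor_coset n M (g * X * ?h)"
    then obtain Z where Z: "Z \<in> reg_ideal n M" "Y = g * X * ?h + Z"
      by (auto simp: factor_coset_def)
    then have "Y = g * (X + ?h * Z * g) * ?h"
      using conj_add[of "?h * Z * g"] conj_inv[of Z] surj[OF Z(1)] by (auto simp: reg_ideal_iff)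
    then show "Y \<in> Ad n g (factor_coset n M X)"
      using surj[OF Z(1)] by (auto simp: Ad_def factor_coset_def)
  qed
qed

section \<open>The dual space and the coadjoint representation\<close>

(* Linearity is expressed through representatives; functionals are extensional, i.e. undefined
   outside the factor algebra, so that equality of functionals is equality of HOL functions. *)
definition dual :: "nat \<Rightarrow> (nat \<times> nat) set \<Rightarrow> ('a::field_char_0 mat set \<Rightarrow> 'a) set" where
  "dual n M = {f \<in> extensional (factor_alg n M).
     \<forall>X\<in>nil_alg n. \<forall>Y\<in>nil_alg n. \<forall>c.
       f (factor_coset n M (X + Y)) = f (factor_coset n M X) + f (factor_coset n M Y) \<and>
       f (factor_coset n M (c \<cdot>\<^sub>m X)) = c * f (factor_coset n M X)}"

definition coAd :: "nat \<Rightarrow> (nat \<times> nat) set \<Rightarrow> 'a::field_char_0 mat \<Rightarrow>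
    ('a mat set \<Rightarrow> 'a) \<Rightarrow> ('a mat set \<Rightarrow> 'a)" where
  "coAd n M g f = (\<lambda>C\<in>factor_alg n M. f (Ad n (inv\<^bsub>UT n\<^esub> g) C))"

section \<open>The symmetric algebra\<close>

(* Polynomials in variables indexed by pairs (i, j): a monomial is a finitely supported exponent
   function, a polynomial a finitely supported coefficient function on monomials. *)
type_synonym 'a pair_poly = "((nat \<times> nat) \<Rightarrow>\<^sub>0 nat) \<Rightarrow>\<^sub>0 'a"

definition Const :: "'a::field_char_0 \<Rightarrow> 'a pair_poly" where
  "Const c = Poly_Mapping.single 0 c"

definition Var :: "nat \<times> nat \<Rightarrow> 'a::field_char_0 pair_poly" where
  "Var \<eta> = Poly_Mapping.single (Poly_Mapping.single \<eta> 1) 1"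

(* Value of p when coefficients are mapped by \<iota> and the variable \<eta> is replaced by \<sigma> \<eta>. *)
definition evaluate ::
    "('a::field_char_0 \<Rightarrow> 'b::comm_ring_1) \<Rightarrow> (nat \<times> nat \<Rightarrow> 'b) \<Rightarrow> 'a pair_poly \<Rightarrow> 'b" where
  "evaluate \<iota> \<sigma> p = (\<Sum>m\<in>Poly_Mapping.keys p. \<iota> (Poly_Mapping.lookup p m) *
      (\<Prod>\<eta>\<in>Poly_Mapping.keys m. \<sigma> \<eta> ^ Poly_Mapping.lookup m \<eta>))"

(* The symmetric algebra of the factor algebra is the polynomial algebra in the images of the
   matrix units outside M, which form a basis of the factor algebra. *)
definition Sym_alg :: "nat \<Rightarrow> (nat \<times> nat) set \<Rightarrow> 'a::field_char_0 pair_poly set" where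
  "Sym_alg n M = {p. \<forall>m\<in>Poly_Mapping.keys p. Poly_Mapping.keys m \<subseteq> pos_roots n - M}"

(* The canonical embedding of the factor algebra into its symmetric algebra; the sum takes the same
   value on all representatives X of a coset C. *)
definition Sym_emb :: "nat \<Rightarrow> (nat \<times> nat) set \<Rightarrow> 'a::field_char_0 mat set \<Rightarrow> 'a pair_poly" where
  "Sym_emb n M C = the_elem ((\<lambda>X. \<Sum>\<eta>\<in>pos_roots n - M. Const (X $$ \<eta>) * Var \<eta>) ` C)"

lemma Sym_emb_factor_coset:
  assumes "X \<in> carrier_mat n n"
  shows "Sym_emb n M (factor_coset n M X) = (\<Sum>\<eta>\<in>pos_roots n - M. Const (X $$ \<eta>) * Var \<eta>)"
proof -
  let ?s = "\<lambda>X::'a mat. \<Sum>\<eta>\<in>pos_roots n - M. Const (X $$ \<eta>) * Var \<eta>"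
  have same: "?s Y = ?s X" if Y: "Y \<in> factor_coset n M X" for Y
  proof -
    obtain Z where Z: "Z \<in> reg_ideal n M" "Y = X + Z"
      using Y unfolding factor_coset_def by blast
    have "Y $$ \<eta> = X $$ \<eta>" if "\<eta> \<in> pos_roots n - M" for \<eta>
      using Z that assms by (cases \<eta>) (auto simp: reg_ideal_iff pos_roots_def)
    then show ?thesis by (intro sum.cong) simp_all
  qed
  have "X = X + 0\<^sub>m n n" using assms by simp
  moreover have "0\<^sub>m n n \<in> reg_ideal n M" by (simp add: reg_ideal_iff)
  ultimately have "X \<in> factor_coset n M X" unfolding factor_coset_def by blast
  then have "?s ` factor_coset n M X = {?s X}"
    using same by blast
  then show ?thesis by (simp add: Sym_emb_def)
qed

(* The algebra endomorphism extending the adjoint action on the factor algebra. *)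
definition Ad_Sym :: "nat \<Rightarrow> (nat \<times> nat) set \<Rightarrow> 'a::field_char_0 mat \<Rightarrow>
    'a pair_poly \<Rightarrow> 'a pair_poly" where
  "Ad_Sym n M g = evaluate Const (\<lambda>\<eta>. Sym_emb n M (Ad n g (factor_coset n M (matrix_unit n \<eta>))))"

definition Sym_invariants :: "nat \<Rightarrow> (nat \<times> nat) set \<Rightarrow> 'a::field_char_0 pair_poly set" where
  "Sym_invariants n M = {p \<in> Sym_alg n M. \<forall>g\<in>carrier (UT n). Ad_Sym n M g p = p}"

section \<open>Regular functions on the dual space\<close>

(* Under the identification of the symmetric algebra with the regular functions on the dual, the
   class of a matrix unit is the function evaluating functionals at that class. *)
definition regular_fun :: "nat \<Rightarrow> (nat \<times> nat) set \<Rightarrow> 'a::field_char_0 pair_poly \<Rightarrow>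
    ('a mat set \<Rightarrow> 'a) \<Rightarrow> 'a" where
  "regular_fun n M p =
     (\<lambda>f\<in>dual n M. evaluate (\<lambda>c. c) (\<lambda>\<eta>. f (factor_coset n M (matrix_unit n \<eta>))) p)"

definition coAd_fun :: "nat \<Rightarrow> (nat \<times> nat) set \<Rightarrow> 'a::field_char_0 mat \<Rightarrow>
    (('a mat set \<Rightarrow> 'a) \<Rightarrow> 'a) \<Rightarrow> ('a mat set \<Rightarrow> 'a) \<Rightarrow> 'a" where
  "coAd_fun n M g F = (\<lambda>f\<in>dual n M. F (coAd n M (inv\<^bsub>UT n\<^esub> g) f))"

definition regular_invariants ::
    "nat \<Rightarrow> (nat \<times> nat) set \<Rightarrow> (('a::field_char_0 mat set \<Rightarrow> 'a) \<Rightarrow> 'a) set" where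
  "regular_invariants n M =
     {F \<in> regular_fun n M ` Sym_alg n M. \<forall>g\<in>carrier (UT n). coAd_fun n M g F = F}"

section \<open>Extremal minors of the characteristic matrix\<close>

definition Phi :: "nat \<Rightarrow> (nat \<times> nat) set \<Rightarrow> 'a::field_char_0 pair_poly mat" where
  "Phi n M = mat n n (\<lambda>\<eta>. if \<eta> \<in> pos_roots n - M then Var \<eta> else 0)"

(* A - \<lambda>E; the library's char_poly_matrix has the opposite sign. *)
definition char_matrix :: "'r::comm_ring_1 mat \<Rightarrow> 'r poly mat" where
  "char_matrix A = map_mat (\<lambda>a. [:a:]) A - [:0, 1:] \<cdot>\<^sub>m 1\<^sub>m (dim_row A)"

definition char_minor :: "'r::comm_ring_1 mat \<Rightarrow> nat set \<Rightarrow> nat set \<Rightarrow> 'r poly" where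
  "char_minor A I J = det (submatrix (char_matrix A) I J)"

definition char_minor_down :: "'r::comm_ring_1 mat \<Rightarrow> nat set \<Rightarrow> nat set \<Rightarrow> nat \<Rightarrow> 'r poly" where
  "char_minor_down A I J i =
     (if i \<in> I \<and> i + 1 \<notin> I then char_minor A ((I - {i}) \<union> {i + 1}) J else 0)"

definition char_minor_left :: "'r::comm_ring_1 mat \<Rightarrow> nat set \<Rightarrow> nat set \<Rightarrow> nat \<Rightarrow> 'r poly" where
  "char_minor_left A I J i =
     (if i + 1 \<in> J \<and> i \<notin> J then char_minor A I ((J - {i + 1}) \<union> {i}) else 0)"

(* The library gives the zero polynomial degree 0, hence the explicit disjuncts. *)
definition extremal :: "'r::comm_ring_1 mat \<Rightarrow> nat set \<Rightarrow> nat set \<Rightarrow> bool" where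
  "extremal A I J \<longleftrightarrow> char_minor A I J \<noteq> 0 \<and>
     (\<forall>i. i + 1 < dim_row A \<longrightarrow>
        (char_minor_left A I J i = 0 \<or>
           degree (char_minor_left A I J i) < degree (char_minor A I J)) \<and>
        (char_minor_down A I J i = 0 \<or>
           degree (char_minor_down A I J i) < degree (char_minor A I J)))"

end

theory Submission
  imports Defs
begin

text \<open>
  Write \<open>\<Phi>\<close> for the formal matrix and \<open>h\<close> for the inverse of \<open>g\<close>. Acting by \<open>g\<close> on the entries of
  \<open>\<Phi>\<close> gives the part of \<open>g\<^sup>T \<Phi> h\<^sup>T\<close> that lies below the diagonal and outside \<open>M\<close>. Only the
  invariance under generators of the unitriangular group has to be shown
  (\<open>UT_simple_induct\<close>), so let \<open>g = E + t E\<^bsub>i+1,i\<^esub>\<close>. Then \<open>h\<^sup>T\<close> is the inverse of \<open>g\<^sup>T\<close>, and what was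
  cut off above and on the diagonal can be corrected before conjugating: with \<open>y = \<Phi>\<^bsub>i+1,i\<^esub>\<close>,
  the transformed matrix minus \<open>\<lambda>E\<close> equals \<open>g\<^sup>T \<Psi> h\<^sup>T\<close>, where \<open>\<Psi>\<close> is \<open>\<Phi> - \<lambda>E\<close> with \<open>\<lambda>\<close> replaced by
  \<open>\<lambda> + t y\<close> and \<open>\<lambda> - t y\<close> at the two diagonal places \<open>i\<close> and \<open>i + 1\<close>, and with an additional
  entry \<open>- t\<^sup>2 y\<close> at the place \<open>(i, i + 1)\<close>.

  Multiplying by \<open>g\<^sup>T\<close> and \<open>h\<^sup>T\<close> adds a row to the row above it and subtracts a column from
  the column to its right. Hence the minor of \<open>g\<^sup>T \<Psi> h\<^sup>T\<close> in rows \<open>I\<close> and columns \<open>J\<close> is a combination of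
  the minors of \<open>\<Psi>\<close> at \<open>(I, J)\<close>, at its downward move, at its left move, and at both moves together. Let \<open>d\<close>
  be the degree of the minor \<open>(I, J)\<close> of \<open>\<Phi> - \<lambda>E\<close>. It remains to see that only the first of the four
  contributes to \<open>\<lambda>\<^sup>d\<close>, and that it contributes the same as \<open>\<Phi> - \<lambda>E\<close> itself
  (\<open>top_coeff_simple_conjugation\<close>).

  This is read off from the Leibniz expansion. A term is a bijection from rows to columns; it is
  admissible if every row is sent either to the diagonal or to a place carrying a variable. Distinct
  admissible bijections give distinct monomials, so nothing cancels and the degree of a minor is
  the largest number of diagonal places used by an admissible bijection
  (\<open>generic_minor_coeff_nonzero\<close>). Consequently changing \<open>\<lambda>\<close> to \<open>\<lambda> + c\<close> at single diagonal places does
  not affect the coefficient of \<open>\<lambda>\<^sup>d\<close>, and the claims about the place \<open>(i, i + 1)\<close> and about the double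
  move become exchange arguments: a bijection that would contradict them is rerouted, using the regularity
  of \<open>M\<close>, into an admissible one for \<open>(I, J)\<close> with more than \<open>d\<close> diagonal places, or for one of
  the two moves with at least \<open>d\<close> of them (\<open>admissible_at_superdiagonal\<close>, \<open>admissible_double_move\<close>).
  The statement for regular functions follows from the one for the symmetric algebra because the
  two actions are intertwined (\<open>regular_fun_coAd\<close>).
\<close>

section \<open>Evaluation of polynomials\<close>

definition monomial_value :: "(nat \<times> nat \<Rightarrow> 'b::comm_ring_1) \<Rightarrow> ((nat \<times> nat) \<Rightarrow>\<^sub>0 nat) \<Rightarrow> 'b" where
  "monomial_value \<sigma> m = (\<Prod>\<eta>\<in>Poly_Mapping.keys m. \<sigma> \<eta> ^ Poly_Mapping.lookup m \<eta>)"

lemma monomial_value_superset: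
  assumes "finite S" "Poly_Mapping.keys m \<subseteq> S"
  shows "monomial_value \<sigma> m = (\<Prod>\<eta>\<in>S. \<sigma> \<eta> ^ Poly_Mapping.lookup m \<eta>)"
  unfolding monomial_value_def using assms
  by (intro prod.mono_neutral_left) (auto simp: in_keys_iff)

lemma monomial_value_add:
  "monomial_value \<sigma> (m + m') = monomial_value \<sigma> m * monomial_value \<sigma> m'"
proof -
  let ?S = "Poly_Mapping.keys m \<union> Poly_Mapping.keys m'"
  have "Poly_Mapping.keys (m + m') \<subseteq> ?S" by (rule Poly_Mapping.keys_add)
  then show ?thesis
    by (simp add: monomial_value_superset[of ?S] lookup_add power_add prod.distrib)
qed

lemma evaluate_superset:
  assumes \<iota>: "comm_ring_hom \<iota>" and "finite S" "Poly_Mapping.keys p \<subseteq> S"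
  shows "evaluate \<iota> \<sigma> p = (\<Sum>m\<in>S. \<iota> (Poly_Mapping.lookup p m) * monomial_value \<sigma> m)"
proof -
  interpret comm_ring_hom \<iota> by fact
  show ?thesis
    unfolding evaluate_def monomial_value_def[symmetric] using assms(2,3)
    by (intro sum.mono_neutral_left) (auto simp: in_keys_iff)
qed

lemma evaluate_single:
  assumes "comm_ring_hom \<iota>"
  shows "evaluate \<iota> \<sigma> (Poly_Mapping.single m c) = \<iota> c * monomial_value \<sigma> m"
  by (simp add: evaluate_superset[OF assms, of "{m}"])

lemma evaluate_add:
  assumes \<iota>: "comm_ring_hom \<iota>"
  shows "evaluate \<iota> \<sigma> (p + q) = evaluate \<iota> \<sigma> p + evaluate \<iota> \<sigma> q"
proof -
  interpret comm_ring_hom \<iota> by fact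
  let ?S = "Poly_Mapping.keys p \<union> Poly_Mapping.keys q"
  have "Poly_Mapping.keys (p + q) \<subseteq> ?S" by (rule Poly_Mapping.keys_add)
  then show ?thesis
    by (simp add: evaluate_superset[OF \<iota>, of ?S] lookup_add hom_add distrib_right sum.distrib)
qed

lemma pair_poly_induct [case_names zero single_add]:
  fixes p :: "'a::field_char_0 pair_poly"
  assumes "Q 0" and "\<And>m c p. Q p \<Longrightarrow> Q (Poly_Mapping.single m c + p)"
  shows "Q p"
proof (induction p rule: update_induct)
  case const
  show ?case by fact
next
  case (update p m c)
  have "Poly_Mapping.update m c p = Poly_Mapping.single m c + p"
    using update(1)
    by (intro poly_mapping_eqI) (auto simp: lookup_update lookup_add lookup_single in_keys_iff)
  then show ?case using assms(2) update by simp
qed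

lemma evaluate_mult:
  assumes \<iota>: "comm_ring_hom \<iota>"
  shows "evaluate \<iota> \<sigma> (p * q) = evaluate \<iota> \<sigma> p * evaluate \<iota> \<sigma> q"
proof -
  interpret comm_ring_hom \<iota> by fact
  have zero: "evaluate \<iota> \<sigma> 0 = 0" by (simp add: evaluate_def)
  have single: "evaluate \<iota> \<sigma> (Poly_Mapping.single m c * q) = \<iota> c * monomial_value \<sigma> m * evaluate \<iota> \<sigma> q"
    for m c q
    by (induction q rule: pair_poly_induct)
      (simp_all add: zero distrib_left mult_single evaluate_add[OF \<iota>] evaluate_single[OF \<iota>]
        monomial_value_add hom_mult mult_ac)
  show ?thesis
    by (induction p rule: pair_poly_induct)
      (simp_all add: zero distrib_right single evaluate_add[OF \<iota>] evaluate_single[OF \<iota>])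
qed

lemma comm_ring_hom_evaluate:
  assumes \<iota>: "comm_ring_hom \<iota>"
  shows "comm_ring_hom (evaluate \<iota> \<sigma>)"
proof
  interpret comm_ring_hom \<iota> by fact
  show "evaluate \<iota> \<sigma> 0 = 0" by (simp add: evaluate_def)
  show "evaluate \<iota> \<sigma> 1 = 1"
    using evaluate_single[OF \<iota>, of \<sigma> 0 1] by (simp add: monomial_value_def)
qed (simp_all add: evaluate_add[OF \<iota>] evaluate_mult[OF \<iota>])

lemma evaluate_Const:
  assumes "comm_ring_hom \<iota>"
  shows "evaluate \<iota> \<sigma> (Const c) = \<iota> c"
  by (simp add: Const_def evaluate_single[OF assms] monomial_value_def)

lemma evaluate_Var:
  assumes "comm_ring_hom \<iota>"
  shows "evaluate \<iota> \<sigma> (Var \<eta>) = \<sigma> \<eta>"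
proof -
  interpret comm_ring_hom \<iota> by fact
  show ?thesis by (simp add: Var_def evaluate_single[OF assms] monomial_value_def)
qed

lemma comm_ring_hom_Const: "comm_ring_hom Const"
  by standard (simp_all add: Const_def single_add mult_single)

lemma comm_ring_hom_id: "comm_ring_hom (\<lambda>c::'a::comm_ring_1. c)"
  by standard simp_all

text \<open>A ring homomorphism after a substitution is again an evaluation. This turns both the composition of two
  actions and the evaluation of a transformed polynomial at a functional into a comparison on variables.\<close>

lemma comp_evaluate:
  assumes h: "comm_ring_hom h"
  shows "h (evaluate Const \<sigma> p) = evaluate (\<lambda>c. h (Const c)) (\<lambda>\<eta>. h (\<sigma> \<eta>)) p"
proof -
  interpret comm_ring_hom h by fact
  show ?thesis
    by (simp add: evaluate_def hom_sum hom_mult hom_prod hom_power)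
qed

text \<open>An element of the symmetric algebra involves only the variables of the factor algebra, so its value
  does not depend on what is substituted for the others.\<close>

lemma evaluate_cong_Sym_alg:
  assumes "p \<in> Sym_alg n M" and "\<And>\<eta>. \<eta> \<in> pos_roots n - M \<Longrightarrow> \<sigma> \<eta> = \<tau> \<eta>"
  shows "evaluate \<iota> \<sigma> p = evaluate \<iota> \<tau> p"
proof -
  have "\<sigma> \<eta> = \<tau> \<eta>" if "m \<in> Poly_Mapping.keys p" "\<eta> \<in> Poly_Mapping.keys m" for m \<eta>
    using that assms unfolding Sym_alg_def by blast
  then show ?thesis unfolding evaluate_def by (auto intro!: sum.cong prod.cong)
qed

lemma Sym_alg_0: "0 \<in> Sym_alg n M" and Sym_alg_1: "1 \<in> Sym_alg n M"
  by (auto simp: Sym_alg_def)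

lemma Sym_alg_Var: "\<eta> \<in> pos_roots n - M \<Longrightarrow> Var \<eta> \<in> Sym_alg n M"
  by (auto simp: Sym_alg_def Var_def)

lemma Sym_alg_add: "p \<in> Sym_alg n M \<Longrightarrow> q \<in> Sym_alg n M \<Longrightarrow> p + q \<in> Sym_alg n M"
  using Poly_Mapping.keys_add[of p q] unfolding Sym_alg_def by blast

lemma Sym_alg_mult:
  assumes "p \<in> Sym_alg n M" "q \<in> Sym_alg n M"
  shows "p * q \<in> Sym_alg n M"
  unfolding Sym_alg_def
proof (intro CollectI ballI)
  fix m assume "m \<in> Poly_Mapping.keys (p * q)"
  then obtain a b where "m = a + b" "a \<in> Poly_Mapping.keys p" "b \<in> Poly_Mapping.keys q"
    using Poly_Mapping.keys_mult[of p q] by blast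
  moreover have "Poly_Mapping.keys (a + b) \<subseteq> Poly_Mapping.keys a \<union> Poly_Mapping.keys b"
    by (rule Poly_Mapping.keys_add)
  ultimately show "Poly_Mapping.keys m \<subseteq> pos_roots n - M"
    using assms unfolding Sym_alg_def by blast
qed

lemma Sym_alg_uminus: "p \<in> Sym_alg n M \<Longrightarrow> - p \<in> Sym_alg n M"
  by (auto simp: Sym_alg_def in_keys_iff)

lemma Sym_alg_sum: "(\<And>x. x \<in> A \<Longrightarrow> f x \<in> Sym_alg n M) \<Longrightarrow> sum f A \<in> Sym_alg n M"
  by (induction A rule: infinite_finite_induct) (auto simp: Sym_alg_0 Sym_alg_add)

section \<open>Generation of the unitriangular group by simple root subgroups\<close>

lemma addrow_UT:
  assumes "g \<in> carrier (UT n)" and "q < p" "p < n"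
  shows "addrow t p q g \<in> carrier (UT n)"
  using assms by (auto simp: carrier_UT)

text \<open>An arbitrary root subgroup is reached from the simple ones by commutators: adding \<open>t\<close> times row
  \<open>q\<close> to row \<open>p + 1\<close> is the same as subtracting it from row \<open>p\<close>, subtracting the new row \<open>p\<close>
  from row \<open>p + 1\<close>, restoring row \<open>p\<close>, and adding row \<open>p\<close> back.\<close>

lemma addrow_simple_generate:
  fixes P :: "'a::field_char_0 mat \<Rightarrow> bool"
  assumes step: "\<And>g t i. g \<in> carrier (UT n) \<Longrightarrow> P g \<Longrightarrow> Suc i < n \<Longrightarrow> P (addrow t (Suc i) i g)"
    and "q < p" "p < n" and "g \<in> carrier (UT n)" "P g"
  shows "P (addrow t p q g)"
  using assms(2-)
proof (induction p arbitrary: t g)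
  case 0
  then show ?case by simp
next
  case (Suc p)
  show ?case
  proof (cases "q = p")
    case True
    then show ?thesis using step Suc.prems by simp
  next
    case False
    then have qp: "q < p" "p < n" using Suc.prems by auto
    define g1 where "g1 = addrow (- t) p q g"
    define g2 where "g2 = addrow (- 1) (Suc p) p g1"
    define g3 where "g3 = addrow t p q g2"
    have g1: "g1 \<in> carrier (UT n)" "P g1"
      using Suc.IH[OF qp Suc.prems(3,4)] addrow_UT[OF Suc.prems(3) qp] by (auto simp: g1_def)
    have g2: "g2 \<in> carrier (UT n)" "P g2"
      using step[OF g1] addrow_UT[OF g1(1)] Suc.prems by (auto simp: g2_def)
    have g3: "g3 \<in> carrier (UT n)" "P g3"
      using Suc.IH[OF qp g2] addrow_UT[OF g2(1) qp] by (auto simp: g3_def)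
    have "g \<in> carrier_mat n n" using Suc.prems by (simp add: carrier_UT)
    then have "addrow t (Suc p) q g = addrow 1 (Suc p) p g3"
      using qp Suc.prems by (intro eq_matI) (auto simp: g1_def g2_def g3_def algebra_simps)
    then show ?thesis using step[OF g3] Suc.prems by simp
  qed
qed

text \<open>The induction principle expressing that the elements \<open>E + t E\<^bsub>i+1,i\<^esub>\<close> generate the group. A matrix is
  reduced to the identity by Gaussian elimination from the top, which removes one nonzero entry below the
  diagonal at a time.\<close>

lemma UT_simple_induct [consumes 1, case_names one simple]:
  fixes P :: "'a::field_char_0 mat \<Rightarrow> bool"
  assumes g: "g \<in> carrier (UT n)" and one: "P (1\<^sub>m n)"
    and step: "\<And>g t i. g \<in> carrier (UT n) \<Longrightarrow> P g \<Longrightarrow> Suc i < n \<Longrightarrow> P (addrow t (Suc i) i g)"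
  shows "P g"
proof -
  define N where "N g = {\<eta> \<in> {..<n} \<times> {..<n}. snd \<eta> < fst \<eta> \<and> g $$ \<eta> \<noteq> 0}" for g :: "'a mat"
  show ?thesis
    using g
  proof (induction "card (N g)" arbitrary: g rule: less_induct)
    case less
    have gc: "g \<in> carrier_mat n n" using less.prems by (simp add: carrier_UT)
    have fin: "finite (N g)" by (auto simp: N_def)
    show ?case
    proof (cases "N g = {}")
      case True
      have "g $$ (a, b) = 0" if "a < n" "b < n" "a \<noteq> b" for a b
        using True that less.prems by (cases "a < b") (auto simp: N_def carrier_UT)
      then have "g = 1\<^sub>m n"
        using less.prems gc by (intro eq_matI) (auto simp: carrier_UT)
      then show ?thesis using one by simp
    next
      case False
      define p where "p = (LEAST p. \<exists>q. (p, q) \<in> N g)"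
      have "\<exists>p q. (p, q) \<in> N g" using False by auto
      then have "\<exists>q. (p, q) \<in> N g" unfolding p_def by (rule LeastI_ex)
      then obtain q where pq: "(p, q) \<in> N g" by blast
      have least: "(a, b) \<notin> N g" if "a < p" for a b
        using not_less_Least[of a "\<lambda>p. \<exists>q. (p, q) \<in> N g"] that by (auto simp: p_def)
      have pqn: "q < p" "p < n" "q < n" "g $$ (p, q) \<noteq> 0" using pq by (auto simp: N_def)
      \<comment> \<open>Row \<open>q\<close> lies above the first nontrivial row, so subtracting a multiple of it from row
        \<open>p\<close> changes the entry \<open>(p, q)\<close> only.\<close>
      have row: "g $$ (q, b) = (if b = q then 1 else 0)" if "b < n" for b
      proof -
        have "(q, b) \<notin> N g" using least pqn by blast
        then show ?thesis
          using less.prems that pqn by (cases b q rule: linorder_cases) (auto simp: N_def carrier_UT)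
      qed
      define g' where "g' = addrow (- g $$ (p, q)) p q g"
      have g': "g' \<in> carrier (UT n)"
        unfolding g'_def using less.prems pqn by (intro addrow_UT) auto
      have entry: "g' $$ (a, b) = (if a = p \<and> b = q then 0 else g $$ (a, b))"
        if "a < n" "b < n" for a b
        using that gc pqn row[of b] by (auto simp: g'_def)
      have "N g' \<subseteq> N g - {(p, q)}" using entry by (auto simp: N_def split: if_splits)
      then have "card (N g') < card (N g)"
        using pq fin by (meson card_Diff1_less card_mono finite_Diff le_less_trans)
      then have "P g'" using less.hyps g' by blast
      moreover have "g = addrow (g $$ (p, q)) p q g'"
        using gc pqn by (intro eq_matI) (auto simp: g'_def)
      ultimately show ?thesis
        using addrow_simple_generate[where P = P, OF step pqn(1,2) g'] by metis
    qed
  qed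
qed

section \<open>Leibniz expansion of minors\<close>

text \<open>The minor with the rows and columns listed by functions rather than given as sets. Moving one row is
  then a function update, with no change of sign and no renumbering, and a move onto a row that is already
  present yields a determinant with two equal rows.\<close>

definition indexed_minor ::
    "nat \<Rightarrow> (nat \<Rightarrow> nat \<Rightarrow> 'r::comm_ring_1) \<Rightarrow> (nat \<Rightarrow> nat) \<Rightarrow> (nat \<Rightarrow> nat) \<Rightarrow> 'r" where
  "indexed_minor k B r c = det (mat k k (\<lambda>(a, b). B (r a) (c b)))"

lemma indexed_minor_Leibniz:
  "indexed_minor k B r c =
     (\<Sum>\<pi> | \<pi> permutes {0..<k}. signof \<pi> * (\<Prod>a = 0..<k. B (r a) (c (\<pi> a))))"
  unfolding indexed_minor_def
  by (subst det_def'[of _ k]) (auto intro!: sum.cong prod.cong simp: permutes_in_image)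

lemma indexed_minor_cong:
  assumes "\<And>a b. a < k \<Longrightarrow> b < k \<Longrightarrow> B (r a) (c b) = B' (r' a) (c' b)"
  shows "indexed_minor k B r c = indexed_minor k B' r' c'"
  unfolding indexed_minor_def by (intro arg_cong[of _ _ det] eq_matI) (auto simp: assms)

lemma indexed_minor_swap:
  "indexed_minor k B r c = indexed_minor k (\<lambda>p q. B q p) c r"
proof -
  have "transpose_mat (mat k k (\<lambda>(a, b). B (r a) (c b))) = mat k k (\<lambda>(a, b). B (r b) (c a))"
    by (intro eq_matI) auto
  then show ?thesis
    unfolding indexed_minor_def by (metis det_transpose mat_carrier)
qed

lemma indexed_minor_repeated_row:
  assumes "a < k" "b < k" "a \<noteq> b" "r a = r b"
  shows "indexed_minor k B r c = 0"
  unfolding indexed_minor_def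
  by (rule det_identical_rows[of _ k a b]) (use assms in \<open>auto intro!: eq_vecI\<close>)

lemma indexed_minor_repeated_col:
  assumes "a < k" "b < k" "a \<noteq> b" "c a = c b"
  shows "indexed_minor k B r c = 0"
  by (subst indexed_minor_swap) (rule indexed_minor_repeated_row[where r = c, OF assms])

lemma indexed_minor_add_row:
  assumes inj: "inj_on r {..<k}" and a0: "a0 < k" "r a0 = i"
  shows "indexed_minor k (\<lambda>p q. B p q + (if p = i then t * B j q else 0)) r c =
         indexed_minor k B r c + t * indexed_minor k B (r(a0 := j)) c"
proof -
  let ?A = "\<lambda>p q. B p q + (if p = i then t * B j q else 0)"
  have other: "r a \<noteq> i" if "a < k" "a \<noteq> a0" for a
    using inj_onD[OF inj, of a a0] that a0 by auto
  have "(\<Prod>a = 0..<k. ?A (r a) (c (\<pi> a))) =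
      (\<Prod>a = 0..<k. B (r a) (c (\<pi> a))) + t * (\<Prod>a = 0..<k. B ((r(a0 := j)) a) (c (\<pi> a)))" for \<pi>
  proof -
    have "(\<Prod>a\<in>{0..<k} - {a0}. ?A (r a) (c (\<pi> a))) = (\<Prod>a\<in>{0..<k} - {a0}. B (r a) (c (\<pi> a)))"
      using other by (intro prod.cong) auto
    moreover have "(\<Prod>a\<in>{0..<k} - {a0}. B ((r(a0 := j)) a) (c (\<pi> a))) =
        (\<Prod>a\<in>{0..<k} - {a0}. B (r a) (c (\<pi> a)))"
      by (intro prod.cong) auto
    ultimately show ?thesis
      using a0 by (simp add: prod.remove[of "{0..<k}" a0] algebra_simps)
  qed
  then show ?thesis
    by (simp add: indexed_minor_Leibniz sum_distrib_left sum.distrib[symmetric] algebra_simps)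
qed

lemma indexed_minor_add_col:
  assumes inj: "inj_on c {..<k}" and b0: "b0 < k" "c b0 = j"
  shows "indexed_minor k (\<lambda>p q. B p q + (if q = j then t * B p i else 0)) r c =
         indexed_minor k B r c + t * indexed_minor k B r (c(b0 := i))"
  using indexed_minor_add_row[OF assms, of "\<lambda>p q. B q p" t i r]
  by (simp add: indexed_minor_swap[of _ _ r])

lemma coeff_indexed_minor:
  fixes B :: "nat \<Rightarrow> nat \<Rightarrow> 'r::comm_ring_1 poly"
  shows "coeff (indexed_minor k B r c) d =
     (\<Sum>\<pi> | \<pi> permutes {0..<k}. signof \<pi> * coeff (\<Prod>a = 0..<k. B (r a) (c (\<pi> a))) d)"
proof -
  have "coeff (signof \<pi> * p) d = signof \<pi> * coeff p d" for \<pi> :: "nat \<Rightarrow> nat" and p :: "'r poly"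
    by (simp add: sign_def)
  then show ?thesis by (simp add: indexed_minor_Leibniz coeff_sum)
qed

section \<open>Top coefficients and admissible bijections\<close>

text \<open>The matrix \<open>f - \<lambda>E\<close> in which the \<open>p\<close>-th diagonal \<open>\<lambda>\<close> is replaced by \<open>\<lambda> + s\<^sub>p\<close>.\<close>

definition shifted_char :: "(nat \<Rightarrow> nat \<Rightarrow> 'r::comm_ring_1) \<Rightarrow> (nat \<Rightarrow> 'r) \<Rightarrow> nat \<Rightarrow> nat \<Rightarrow> 'r poly" where
  "shifted_char f s p q = [:f p q:] - (if p = q then [:s p, 1:] else 0)"

definition diag_hits :: "nat \<Rightarrow> (nat \<Rightarrow> nat) \<Rightarrow> (nat \<Rightarrow> nat) \<Rightarrow> (nat \<Rightarrow> nat) \<Rightarrow> nat set" where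
  "diag_hits k r c \<pi> = {a \<in> {0..<k}. r a = c (\<pi> a)}"

text \<open>The part of a Leibniz term that does not involve \<open>\<lambda>\<close>.\<close>

definition off_weight ::
    "nat \<Rightarrow> (nat \<Rightarrow> nat \<Rightarrow> 'r::comm_ring_1) \<Rightarrow> (nat \<Rightarrow> nat) \<Rightarrow> (nat \<Rightarrow> nat) \<Rightarrow> (nat \<Rightarrow> nat) \<Rightarrow> 'r" where
  "off_weight k f r c \<pi> = (\<Prod>a\<in>{0..<k} - diag_hits k r c \<pi>. f (r a) (c (\<pi> a)))"

text \<open>The bijections from rows to columns whose Leibniz term does not vanish when \<open>Q\<close> is the set of places
  carrying a variable.\<close>

definition admissible ::
    "(nat \<times> nat) set \<Rightarrow> nat \<Rightarrow> (nat \<Rightarrow> nat) \<Rightarrow> (nat \<Rightarrow> nat) \<Rightarrow> (nat \<Rightarrow> nat) \<Rightarrow> bool" where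
  "admissible Q k r c \<pi> \<longleftrightarrow> \<pi> permutes {0..<k} \<and>
     (\<forall>a<k. r a = c (\<pi> a) \<or> (r a, c (\<pi> a)) \<in> Q)"

lemma degree_coeff_prod_linear:
  fixes s :: "'b \<Rightarrow> 'r::comm_ring_1"
  assumes "finite A"
  shows "degree (\<Prod>a\<in>A. - [:s a, 1:]) \<le> card A \<and> coeff (\<Prod>a\<in>A. - [:s a, 1:]) (card A) = (- 1) ^ card A"
  using assms
proof (induction A rule: finite_induct)
  case empty
  show ?case by simp
next
  case (insert x F)
  let ?p = "\<Prod>a\<in>F. - [:s a, 1:]"
  have "- [:s x, 1:] * ?p = smult (- s x) ?p - pCons 0 ?p" by simp
  moreover have "degree (smult (- s x) ?p) \<le> Suc (card F)"
    using insert degree_smult_le[of "- s x" ?p] by linarith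
  moreover have "degree (pCons 0 ?p) \<le> Suc (card F)"
    using insert degree_pCons_le[of 0 ?p] by linarith
  moreover have "coeff ?p (Suc (card F)) = 0" using insert by (intro coeff_eq_0) auto
  ultimately show ?case
    using insert by (auto intro: degree_diff_le)
qed

lemma shifted_char_prod:
  assumes f: "\<And>p. f p p = 0"
  shows "(\<Prod>a = 0..<k. shifted_char f s (r a) (c (\<pi> a))) =
    smult (off_weight k f r c \<pi>) (\<Prod>a\<in>diag_hits k r c \<pi>. - [:s (r a), 1:])"
proof -
  let ?S = "diag_hits k r c \<pi>"
  have S: "?S \<subseteq> {0..<k}" by (auto simp: diag_hits_def)
  have const: "(\<Prod>a\<in>A. [:g a:]) = [:\<Prod>a\<in>A. g a:]" if "finite A" for A :: "nat set" and g :: "nat \<Rightarrow> 'a"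
    using that by (induction A rule: finite_induct) (simp_all add: one_pCons)
  have "(\<Prod>a = 0..<k. shifted_char f s (r a) (c (\<pi> a))) =
     (\<Prod>a\<in>{0..<k} - ?S. shifted_char f s (r a) (c (\<pi> a))) * (\<Prod>a\<in>?S. shifted_char f s (r a) (c (\<pi> a)))"
    by (rule prod.subset_diff[OF S]) simp
  also have "(\<Prod>a\<in>{0..<k} - ?S. shifted_char f s (r a) (c (\<pi> a))) = (\<Prod>a\<in>{0..<k} - ?S. [:f (r a) (c (\<pi> a)):])"
    by (intro prod.cong) (auto simp: shifted_char_def diag_hits_def)
  also have "\<dots> = [:\<Prod>a\<in>{0..<k} - ?S. f (r a) (c (\<pi> a)):]" by (rule const) simp
  also have "(\<Prod>a\<in>?S. shifted_char f s (r a) (c (\<pi> a))) = (\<Prod>a\<in>?S. - [:s (r a), 1:])"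
    by (intro prod.cong) (auto simp: shifted_char_def diag_hits_def f)
  finally show ?thesis by (simp add: off_weight_def)
qed

lemma off_weight_cong:
  assumes "\<And>a. a < k \<Longrightarrow> r a \<noteq> c (\<pi> a) \<Longrightarrow> f (r a) (c (\<pi> a)) = f' (r' a) (c' (\<pi> a))"
    and "diag_hits k r c \<pi> = diag_hits k r' c' \<pi>"
  shows "off_weight k f r c \<pi> = off_weight k f' r' c' \<pi>"
  unfolding off_weight_def assms(2)
  by (intro prod.cong refl) (use assms in \<open>auto simp: diag_hits_def\<close>)

lemma admissible_if_off_weight:
  assumes "\<pi> permutes {0..<k}" "off_weight k f r c \<pi> \<noteq> 0"
    and Q: "\<And>p q. f p q \<noteq> 0 \<Longrightarrow> (p, q) \<in> Q"
  shows "admissible Q k r c \<pi>"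
proof -
  have "(r a, c (\<pi> a)) \<in> Q" if "a < k" "r a \<noteq> c (\<pi> a)" for a
  proof (rule Q, rule notI)
    assume "f (r a) (c (\<pi> a)) = 0"
    then have "off_weight k f r c \<pi> = 0"
      unfolding off_weight_def using that by (intro prod_zero) (auto simp: diag_hits_def)
    then show False using assms by simp
  qed
  then show ?thesis using assms by (auto simp: admissible_def)
qed

text \<open>A Leibniz term is its weight times a product of linear factors, one for each diagonal place that it
  uses. If no nonzero term uses more than \<open>d\<close> of them, the coefficient of \<open>\<lambda>\<^sup>d\<close> collects the leading
  coefficients of those factors, and the shifts \<open>s\<close> disappear from it.\<close>

lemma top_coeff_indexed_minor:
  assumes f: "\<And>p. f p p = 0"
    and bound: "\<And>\<pi>. \<pi> permutes {0..<k} \<Longrightarrow> off_weight k f r c \<pi> \<noteq> 0 \<Longrightarrow> card (diag_hits k r c \<pi>) \<le> d"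
  shows "coeff (indexed_minor k (shifted_char f s) r c) d =
    (\<Sum>\<pi> | \<pi> permutes {0..<k}. signof \<pi> *
       (if card (diag_hits k r c \<pi>) = d then (- 1) ^ d * off_weight k f r c \<pi> else 0))"
  unfolding coeff_indexed_minor
proof (intro sum.cong refl arg_cong2[where f = "(*)"], unfold mem_Collect_eq)
  fix \<pi> assume \<pi>: "\<pi> permutes {0..<k}"
  let ?S = "diag_hits k r c \<pi>"
  let ?p = "\<Prod>a\<in>?S. - [:s (r a), 1:]"
  have "finite ?S" by (simp add: diag_hits_def)
  then have deg: "degree ?p \<le> card ?S" "coeff ?p (card ?S) = (- 1) ^ card ?S"
    using degree_coeff_prod_linear[of ?S "\<lambda>a. s (r a)"] by auto
  show "coeff (\<Prod>a = 0..<k. shifted_char f s (r a) (c (\<pi> a))) d =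
      (if card ?S = d then (- 1) ^ d * off_weight k f r c \<pi> else 0)"
  proof (cases "off_weight k f r c \<pi> = 0 \<or> card ?S = d")
    case True
    then show ?thesis using deg by (auto simp: shifted_char_prod[of f, OF f] mult.commute)
  next
    case False
    then have "coeff ?p d = 0" using bound[OF \<pi>] deg by (intro coeff_eq_0) simp
    then show ?thesis using False by (simp add: shifted_char_prod[of f, OF f])
  qed
qed

lemma top_coeff_indexed_minor_zero:
  assumes f: "\<And>p. f p p = 0" and Q: "\<And>p q. f p q \<noteq> 0 \<Longrightarrow> (p, q) \<in> Q"
    and bound: "\<And>\<pi>. admissible Q k r c \<pi> \<Longrightarrow> card (diag_hits k r c \<pi>) < d"
  shows "coeff (indexed_minor k (shifted_char f s) r c) d = 0"
proof -
  have *: "card (diag_hits k r c \<pi>) < d" if "\<pi> permutes {0..<k}" "off_weight k f r c \<pi> \<noteq> 0" for \<pi>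
    using bound admissible_if_off_weight[OF that Q] by blast
  show ?thesis
    using * by (subst top_coeff_indexed_minor[OF f]) (fastforce intro!: sum.neutral)+
qed

definition generic_entry :: "(nat \<times> nat) set \<Rightarrow> nat \<Rightarrow> nat \<Rightarrow> 'a::field_char_0 pair_poly" where
  "generic_entry Q p q = (if (p, q) \<in> Q then Var (p, q) else 0)"

lemma generic_entry_support: "generic_entry Q p q \<noteq> 0 \<Longrightarrow> (p, q) \<in> Q"
  by (simp add: generic_entry_def split: if_splits)

lemma lookup_signof_mult:
  "Poly_Mapping.lookup (signof \<pi> * p :: 'a::field_char_0 pair_poly) m = signof \<pi> * Poly_Mapping.lookup p m"
  by (simp add: sign_def)

lemma prod_Var:
  "finite A \<Longrightarrow> (\<Prod>a\<in>A. Var (f a)) = Poly_Mapping.single (\<Sum>a\<in>A. Poly_Mapping.single (f a) 1) 1"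
  by (induction A rule: finite_induct) (simp_all add: Var_def mult_single)

lemma keys_sum_single:
  fixes f :: "'b \<Rightarrow> 'c"
  assumes "finite A"
  shows "Poly_Mapping.keys (\<Sum>a\<in>A. Poly_Mapping.single (f a) (1::nat)) = f ` A"
  using assms
proof (induction A rule: finite_induct)
  case (insert x F)
  have "Poly_Mapping.keys (Poly_Mapping.single y (1::nat) + m) = insert y (Poly_Mapping.keys m)"
    for y and m :: "'c \<Rightarrow>\<^sub>0 nat"
    by (rule Set.set_eqI) (auto simp: in_keys_iff lookup_add lookup_single when_def split: if_splits)
  then show ?case using insert by simp
qed simp

text \<open>Since the weight of an admissible bijection is the product of the variables at its off-diagonal
  places, it determines the bijection: the variables give its values on those rows, and every other row must go to
  the diagonal. So the terms with a given power of \<open>\<lambda>\<close> have distinct monomials and cannot cancel.\<close>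

lemma generic_minor_coeff_nonzero:
  assumes Q: "\<And>p. (p, p) \<notin> Q"
    and r: "inj_on r {..<k}" and c: "inj_on c {..<k}"
    and adm: "admissible Q k r c \<pi>0"
  shows "coeff (indexed_minor k (shifted_char (generic_entry Q :: nat \<Rightarrow> nat \<Rightarrow> 'a::field_char_0 pair_poly) (\<lambda>_. 0)) r c)
           (card (diag_hits k r c \<pi>0)) \<noteq> 0"
proof -
  let ?g = "generic_entry Q :: nat \<Rightarrow> nat \<Rightarrow> 'a pair_poly"
  define off where "off \<pi> = {0..<k} - diag_hits k r c \<pi>" for \<pi>
  define mon where "mon \<pi> = (\<Sum>a\<in>off \<pi>. Poly_Mapping.single (r a, c (\<pi> a)) (1::nat))" for \<pi>
  define e where "e = card (diag_hits k r c \<pi>0)"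
  have g: "?g p p = 0" for p using Q by (simp add: generic_entry_def)
  have perm0: "\<pi>0 permutes {0..<k}" using adm by (simp add: admissible_def)
  have weight: "off_weight k ?g r c \<pi> = Poly_Mapping.single (mon \<pi>) 1" if "admissible Q k r c \<pi>" for \<pi>
  proof -
    have "off_weight k ?g r c \<pi> = (\<Prod>a\<in>off \<pi>. Var (r a, c (\<pi> a)))"
      unfolding off_weight_def off_def
      using that by (intro prod.cong) (auto simp: generic_entry_def admissible_def diag_hits_def)
    then show ?thesis by (simp add: prod_Var off_def mon_def)
  qed
  have unique: "\<pi> = \<pi>0" if \<pi>: "\<pi> permutes {0..<k}" and eq: "mon \<pi> = mon \<pi>0" for \<pi>
  proof -
    have "Poly_Mapping.keys (mon \<tau>) = (\<lambda>a. (r a, c (\<tau> a))) ` off \<tau>" for \<tau>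
      unfolding mon_def by (rule keys_sum_single) (simp add: off_def)
    then have eq_img: "(\<lambda>a. (r a, c (\<pi> a))) ` off \<pi> = (\<lambda>a. (r a, c (\<pi>0 a))) ` off \<pi>0"
      using eq by metis
    then have graph: "(r a, c (\<pi> a)) \<in> (\<lambda>a. (r a, c (\<pi>0 a))) ` off \<pi>0" if "a \<in> off \<pi>" for a
      using that by blast
    have graph0: "(r a, c (\<pi>0 a)) \<in> (\<lambda>a. (r a, c (\<pi> a))) ` off \<pi>" if "a \<in> off \<pi>0" for a
      using eq_img that by blast
    have "c (\<pi> a) = c (\<pi>0 a)" if a: "a < k" for a
    proof (cases "a \<in> off \<pi>")
      case True
      then obtain b where "b \<in> off \<pi>0" "r a = r b" "c (\<pi> a) = c (\<pi>0 b)"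
        using graph[OF True] by auto
      then show ?thesis using inj_onD[OF r, of a b] a by (auto simp: off_def)
    next
      case False
      have "a \<notin> off \<pi>0"
      proof
        assume "a \<in> off \<pi>0"
        then obtain b where b: "b \<in> off \<pi>" "r a = r b" using graph0[of a] by auto
        then have "a = b" using inj_onD[OF r, of a b] a by (auto simp: off_def)
        then show False using b False by simp
      qed
      then show ?thesis using False a by (auto simp: off_def diag_hits_def)
    qed
    then have "\<pi> a = \<pi>0 a" if "a < k" for a
      using that inj_onD[OF c, of "\<pi> a" "\<pi>0 a"] permutes_in_image[OF \<pi>, of a]
        permutes_in_image[OF perm0, of a] by auto
    moreover have "\<pi> a = \<pi>0 a" if "\<not> a < k" for a
      using that permutes_not_in[OF \<pi>, of a] permutes_not_in[OF perm0, of a] by auto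
    ultimately show ?thesis by blast
  qed
  have summand: "Poly_Mapping.lookup (coeff (\<Prod>a = 0..<k. shifted_char ?g (\<lambda>_. 0) (r a) (c (\<pi> a))) e) (mon \<pi>0) =
      (if \<pi> = \<pi>0 then (- 1) ^ e else 0)" if \<pi>: "\<pi> permutes {0..<k}" for \<pi>
  proof -
    let ?S = "diag_hits k r c \<pi>"
    have lam: "- [:0, 1:] = monom (- 1 :: 'a pair_poly) 1" by (simp add: monom_altdef)
    have "(\<Prod>a\<in>?S. - [:0, 1 :: 'a pair_poly:]) = monom ((- 1) ^ card ?S) (card ?S)"
      unfolding lam by (simp add: monom_power)
    then have prod: "coeff (\<Prod>a = 0..<k. shifted_char ?g (\<lambda>_. 0) (r a) (c (\<pi> a))) e =
        (if card ?S = e then (- 1) ^ e * off_weight k ?g r c \<pi> else 0)"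
      by (simp add: shifted_char_prod[of ?g, OF g] mult.commute)
    have sign: "Poly_Mapping.lookup ((- 1) ^ j * p :: 'a pair_poly) m = (- 1) ^ j * Poly_Mapping.lookup p m" for j p m
      by (cases "even j") simp_all
    show ?thesis
    proof (cases "admissible Q k r c \<pi>")
      case True
      then show ?thesis
        unfolding prod using unique[OF \<pi>] weight[OF True]
        by (auto simp: sign lookup_single when_def e_def)
    next
      case False
      then have "off_weight k ?g r c \<pi> = 0"
        using admissible_if_off_weight[OF \<pi> _ generic_entry_support] by blast
      then show ?thesis using False adm prod by auto
    qed
  qed
  have "Poly_Mapping.lookup (coeff (indexed_minor k (shifted_char ?g (\<lambda>_. 0)) r c) e) (mon \<pi>0) =
      (\<Sum>\<pi> | \<pi> permutes {0..<k}. signof \<pi> * (if \<pi> = \<pi>0 then (- 1) ^ e else 0))"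
    by (simp add: coeff_indexed_minor lookup_sum lookup_signof_mult summand)
  also have "\<dots> = signof \<pi>0 * (- 1) ^ e"
    using perm0 by (simp add: finite_permutations if_distrib[of "(*) _"] cong: if_cong)
  also have "\<dots> \<noteq> 0" by (simp add: sign_def)
  finally show ?thesis unfolding e_def by auto
qed

section \<open>Conjugation by a simple root element\<close>

text \<open>The form in which the exchange arguments count: all diagonal places are kept and the one in row
  \<open>a0\<close> is new.\<close>

lemma card_diag_hits_less:
  assumes "\<And>a. a < k \<Longrightarrow> r a = c (\<pi> a) \<Longrightarrow> r' a = c' (\<pi>' a)"
    and "a0 < k" "r a0 \<noteq> c (\<pi> a0)" "r' a0 = c' (\<pi>' a0)"
  shows "card (diag_hits k r c \<pi>) < card (diag_hits k r' c' \<pi>')"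
proof (rule psubset_card_mono)
  have "a0 \<in> diag_hits k r' c' \<pi>' - diag_hits k r c \<pi>" using assms(2-4) by (simp add: diag_hits_def)
  moreover have "diag_hits k r c \<pi> \<subseteq> diag_hits k r' c' \<pi>'" using assms(1) by (auto simp: diag_hits_def)
  ultimately show "diag_hits k r c \<pi> \<subset> diag_hits k r' c' \<pi>'" by blast
qed (simp add: diag_hits_def)

text \<open>What is used of the complement of a regular set of roots. The closure conditions are regularity, in
  contrapositive form, with respect to the simple root \<open>(i + 1, i)\<close>.\<close>

locale root_set =
  fixes Q :: "(nat \<times> nat) set"
  assumes below: "(p, q) \<in> Q \<Longrightarrow> q < p"
    and col_closed: "(p, i) \<in> Q \<Longrightarrow> Suc i < p \<Longrightarrow> (p, Suc i) \<in> Q"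
    and row_closed: "(Suc i, q) \<in> Q \<Longrightarrow> q < i \<Longrightarrow> (i, q) \<in> Q"

text \<open>Extremality at \<open>i\<close> in terms of bijections, for the rows \<open>r\<close> and columns \<open>c\<close> of a minor of degree
  \<open>d\<close>.\<close>

locale extremal_position = root_set +
  fixes k :: nat and r c :: "nat \<Rightarrow> nat" and d i :: nat
  assumes inj_r: "inj_on r {..<k}" and inj_c: "inj_on c {..<k}"
    and top: "admissible Q k r c \<pi> \<Longrightarrow> card (diag_hits k r c \<pi>) \<le> d"
    and down: "a < k \<Longrightarrow> r a = i \<Longrightarrow> Suc i \<notin> r ` {..<k} \<Longrightarrow>
      admissible Q k (r(a := Suc i)) c \<pi> \<Longrightarrow> card (diag_hits k (r(a := Suc i)) c \<pi>) < d"
    and left: "b < k \<Longrightarrow> c b = Suc i \<Longrightarrow> i \<notin> c ` {..<k} \<Longrightarrow>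
      admissible Q k r (c(b := i)) \<pi> \<Longrightarrow> card (diag_hits k r (c(b := i)) \<pi>) < d"
begin

text \<open>The exceptional entry at \<open>(i, i + 1)\<close> does not reach the coefficient of \<open>\<lambda>\<^sup>d\<close>. If row \<open>i + 1\<close> is
  not among the rows, moving row \<open>i\<close> down puts this place on the diagonal, and the downward move bounds the
  count; likewise for column \<open>i\<close> and the left move. If both are present, let \<open>a0\<close> be the position of row \<open>i\<close> and \<open>a2\<close>
  that of the row sent to column \<open>i\<close>. Exchanging the images of \<open>a2\<close> and \<open>a0\<close> sends row \<open>i\<close> to the diagonal, and
  the row at \<open>a2\<close> to column \<open>i + 1\<close>, which is allowed by regularity; the number of diagonal places grows.\<close>

lemma admissible_at_superdiagonal:
  assumes adm: "admissible (insert (i, Suc i) Q) k r c \<pi>"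
    and a0: "a0 < k" "r a0 = i" "c (\<pi> a0) = Suc i"
  shows "card (diag_hits k r c \<pi>) < d"
proof -
  have perm: "\<pi> permutes {0..<k}" using adm by (simp add: admissible_def)
  have \<pi>k: "\<pi> a < k \<longleftrightarrow> a < k" for a using permutes_in_image[OF perm, of a] by simp
  have \<pi>inj: "\<pi> a = \<pi> b \<longleftrightarrow> a = b" for a b using permutes_inj[OF perm] by (simp add: inj_eq)
  have r_a0: "r a = i \<longleftrightarrow> a = a0" if "a < k" for a using inj_onD[OF inj_r, of a a0] that a0 by auto
  have other: "r a = c (\<pi> a) \<or> (r a, c (\<pi> a)) \<in> Q" if "a < k" "a \<noteq> a0" for a
    using adm that r_a0 by (auto simp: admissible_def)
  consider "Suc i \<notin> r ` {..<k}" | "i \<notin> c ` {..<k}" | "Suc i \<in> r ` {..<k}" "i \<in> c ` {..<k}" by blast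
  then show ?thesis
  proof cases
    case 1
    have "admissible Q k (r(a0 := Suc i)) c \<pi>" using perm other a0 by (auto simp: admissible_def)
    then have "card (diag_hits k (r(a0 := Suc i)) c \<pi>) < d" by (rule down[OF a0(1,2) 1])
    moreover have "card (diag_hits k r c \<pi>) < card (diag_hits k (r(a0 := Suc i)) c \<pi>)"
      by (rule card_diag_hits_less[of _ _ _ _ _ _ _ a0]) (use a0 in auto)
    ultimately show ?thesis by simp
  next
    case 2
    have "admissible Q k r (c(\<pi> a0 := i)) \<pi>" using perm other a0 by (auto simp: admissible_def \<pi>inj)
    then have "card (diag_hits k r (c(\<pi> a0 := i)) \<pi>) < d"
      by (rule left[OF \<pi>k[THEN iffD2, OF a0(1)] a0(3) 2])
    moreover have "card (diag_hits k r c \<pi>) < card (diag_hits k r (c(\<pi> a0 := i)) \<pi>)"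
      by (rule card_diag_hits_less[of _ _ _ _ _ _ _ a0]) (use a0 in \<open>auto simp: \<pi>inj\<close>)
    ultimately show ?thesis by simp
  next
    case 3
    then obtain b1 where b1: "b1 < k" "c b1 = i" by auto
    have "b1 \<in> \<pi> ` {0..<k}" using permutes_image[OF perm] b1 by simp
    then obtain a2 where a2: "a2 < k" and \<pi>a2: "\<pi> a2 = b1" by auto
    have ne: "a2 \<noteq> a0" using \<pi>a2 b1 a0 by auto
    have "(r a2, i) \<in> Q" using other[OF a2 ne] r_a0[OF a2] ne b1 \<pi>a2 by auto
    then have ra2: "r a2 = Suc i \<or> (r a2, Suc i) \<in> Q"
      using below col_closed by (metis Suc_lessI)
    define \<pi>' where "\<pi>' = \<pi> \<circ> Transposition.transpose a0 a2"
    have perm': "\<pi>' permutes {0..<k}"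
      unfolding \<pi>'_def using a0 a2 perm by (intro permutes_compose permutes_swap_id) auto
    have \<pi>': "\<pi>' a0 = b1" "\<pi>' a2 = \<pi> a0" "a \<noteq> a0 \<Longrightarrow> a \<noteq> a2 \<Longrightarrow> \<pi>' a = \<pi> a" for a
      by (auto simp: \<pi>'_def \<pi>a2 transpose_def)
    have "r a = c (\<pi>' a) \<or> (r a, c (\<pi>' a)) \<in> Q" if "a < k" for a
      using other[OF that] \<pi>'(1,2) \<pi>'(3)[of a] a0 b1 ra2 by (cases "a = a0"; cases "a = a2") auto
    then have "admissible Q k r c \<pi>'" using perm' by (simp add: admissible_def)
    then have "card (diag_hits k r c \<pi>') \<le> d" by (rule top)
    moreover have "card (diag_hits k r c \<pi>) < card (diag_hits k r c \<pi>')"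
    proof (rule card_diag_hits_less[of _ _ _ _ _ _ _ a0])
      fix a assume a: "a < k" "r a = c (\<pi> a)"
      have "r a0 \<noteq> c (\<pi> a0)" "r a2 \<noteq> c (\<pi> a2)" using \<pi>a2 b1 r_a0[OF a2] ne a0 by auto
      then have "a \<noteq> a0" "a \<noteq> a2" using a(2) by auto
      then show "r a = c (\<pi>' a)" using \<pi>'(3) a(2) by simp
    qed (use a0 b1 \<pi>'(1) in auto)
    ultimately show ?thesis by simp
  qed
qed

text \<open>A bijection for the double move also serves for the downward move alone: the row that it sends to
  column \<open>i\<close> is not row \<open>i\<close>, so by regularity it may as well be sent to column \<open>i + 1\<close>.\<close>

lemma admissible_double_move:
  assumes a0: "a0 < k" "r a0 = i" "Suc i \<notin> r ` {..<k}"
    and b0: "b0 < k" "c b0 = Suc i" "i \<notin> c ` {..<k}"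
    and adm: "admissible Q k (r(a0 := Suc i)) (c(b0 := i)) \<pi>"
  shows "card (diag_hits k (r(a0 := Suc i)) (c(b0 := i)) \<pi>) < d"
proof -
  let ?r = "r(a0 := Suc i)"
  have row: "?r a \<noteq> i" if "a < k" for a using inj_onD[OF inj_r, of a a0] that a0 by auto
  have entry: "?r a = c (\<pi> a) \<or> (?r a, c (\<pi> a)) \<in> Q" if "a < k" for a
  proof (cases "\<pi> a = b0")
    case True
    then have "(?r a, i) \<in> Q" using adm that row[OF that] by (auto simp: admissible_def)
    then have "?r a = Suc i \<or> (?r a, Suc i) \<in> Q"
      using below col_closed by (metis Suc_lessI)
    then show ?thesis using True b0 by simp
  next
    case False
    then show ?thesis using adm that by (auto simp: admissible_def)
  qed
  have "diag_hits k ?r (c(b0 := i)) \<pi> \<subseteq> diag_hits k ?r c \<pi>"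
    using row by (force simp: diag_hits_def split: if_splits)
  then have "card (diag_hits k ?r (c(b0 := i)) \<pi>) \<le> card (diag_hits k ?r c \<pi>)"
    by (rule card_mono[rotated]) (simp add: diag_hits_def)
  moreover have "admissible Q k ?r c \<pi>" using adm entry by (simp add: admissible_def)
  ultimately show ?thesis using down[OF a0] by (meson le_less_trans)
qed

text \<open>Here \<open>f'\<close> is the matrix obtained by the action of \<open>E + t E\<^bsub>i+1,i\<^esub>\<close> on the entries of \<open>f\<close>. The matrices
  \<open>\<Psi>\<close> and \<open>\<Xi>\<close> of the proof are the corrected characteristic matrix and its product
  on the right with the transpose of \<open>E - t E\<^bsub>i+1,i\<^esub>\<close>.\<close>

lemma top_coeff_simple_conjugation:
  fixes f :: "nat \<Rightarrow> nat \<Rightarrow> 'r::comm_ring_1" and t :: 'r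
  assumes supp: "\<And>p q. f p q \<noteq> 0 \<Longrightarrow> (p, q) \<in> Q"
  defines "f' \<equiv> \<lambda>p q. if (p, q) \<in> Q
    then f p q + (if p = i then t * f (Suc i) q else 0) - (if q = Suc i then t * f p i else 0) else 0"
  shows "coeff (indexed_minor k (shifted_char f' (\<lambda>_. 0)) r c) d =
         coeff (indexed_minor k (shifted_char f (\<lambda>_. 0)) r c) d"
proof -
  \<comment> \<open>The shifts and the extra entry are forced by the identity of \<open>f' - \<lambda>E\<close> with the conjugate of \<open>\<Psi>\<close>
    on the diagonal and at \<open>(i, i + 1)\<close>, where \<open>f'\<close> vanishes.\<close>
  define y where "y = f (Suc i) i"
  define s where "s p = (if p = i then t * y else if p = Suc i then - t * y else 0)" for p
  define h where "h p q = f p q - (if p = i \<and> q = Suc i then t\<^sup>2 * y else 0)" for p q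
  define \<Psi> where "\<Psi> = shifted_char h s"
  define \<Xi> where "\<Xi> p q = \<Psi> p q + (if q = Suc i then [:- t:] * \<Psi> p i else 0)" for p q
  have f0: "f p q = 0" if "p \<le> q" for p q using supp[of p q] below that by force
  have h_diag: "h p p = 0" for p by (auto simp: h_def f0)
  have f_diag: "f p p = 0" for p by (simp add: f0)
  \<comment> \<open>Below the diagonal, cutting off at the places outside \<open>Q\<close> removes nothing, by the closure conditions.\<close>
  have f'_eq: "f' p q = f p q + (if p = i then t * f (Suc i) q else 0) - (if q = Suc i then t * f p i else 0)"
    if "q < p" for p q
  proof (cases "(p, q) \<in> Q")
    case True
    then show ?thesis by (simp add: f'_def)
  next
    case False
    then have "f p q = 0" "p = i \<Longrightarrow> f (Suc i) q = 0" "q = Suc i \<Longrightarrow> f p i = 0"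
      using supp that row_closed col_closed by blast+
    then show ?thesis using False by (auto simp: f'_def)
  qed
  have f'0: "f' p q = 0" if "p \<le> q" for p q using below that by (force simp: f'_def)
  have entrywise: "shifted_char f' (\<lambda>_. 0) p q = \<Xi> p q + (if p = i then [:t:] * \<Xi> (Suc i) q else 0)" for p q
  proof -
    consider "q < p" | "p = q" "p = i" | "p = q" "p = Suc i" | "p = q" "p \<noteq> i" "p \<noteq> Suc i"
      | "p = i" "q = Suc i" | "p < q" "p \<noteq> i \<or> q \<noteq> Suc i" by linarith
    then show ?thesis
      by cases
        (auto simp: \<Xi>_def \<Psi>_def shifted_char_def f'_eq f'0 f0 h_def s_def y_def power2_eq_square algebra_simps)
  qed
  have \<Psi>_f: "indexed_minor k \<Psi> r' c' = indexed_minor k (shifted_char f s) r' c'"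
    if "(\<forall>a<k. r' a \<noteq> i) \<or> (\<forall>b<k. c' b \<noteq> Suc i)" for r' c'
    using that by (intro indexed_minor_cong) (auto simp: \<Psi>_def shifted_char_def h_def)
  have expand_col: "coeff (indexed_minor k \<Xi> r' c) d = coeff (indexed_minor k \<Psi> r' c) d"
    if zero: "\<And>b. b < k \<Longrightarrow> c b = Suc i \<Longrightarrow> coeff (indexed_minor k \<Psi> r' (c(b := i))) d = 0" for r'
  proof (cases "Suc i \<in> c ` {..<k}")
    case True
    then obtain b where b: "b < k" "c b = Suc i" by auto
    have "indexed_minor k \<Xi> r' c = indexed_minor k \<Psi> r' c + [:- t:] * indexed_minor k \<Psi> r' (c(b := i))"
      unfolding \<Xi>_def by (rule indexed_minor_add_col[OF inj_c b])
    then show ?thesis using zero[OF b] by simp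
  next
    case False
    then have "c b \<noteq> Suc i" if "b < k" for b using that by (metis imageI lessThan_iff)
    then show ?thesis
      by (intro arg_cong[where f = "\<lambda>p. coeff p d"] indexed_minor_cong) (simp add: \<Xi>_def)
  qed
  \<comment> \<open>The two minors of the downward move; row \<open>i\<close> is absent, so \<open>\<Psi>\<close> agrees there with the matrix without the extra entry.\<close>
  have down0: "coeff (indexed_minor k \<Xi> (r(a := Suc i)) c) d = 0" if a: "a < k" "r a = i" for a
  proof (cases "Suc i \<in> r ` {..<k}")
    case True
    then obtain a' where "a' < k" "r a' = Suc i" by auto
    then have "indexed_minor k \<Xi> (r(a := Suc i)) c = 0"
      using a by (intro indexed_minor_repeated_row[of a _ a']) auto
    then show ?thesis by simp
  next
    case new: False
    have row: "\<forall>a'<k. (r(a := Suc i)) a' \<noteq> i"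
    proof (intro allI impI)
      fix a' assume "a' < k"
      then show "(r(a := Suc i)) a' \<noteq> i" using inj_onD[OF inj_r, of a' a] a by (cases "a' = a") auto
    qed
    have "coeff (indexed_minor k \<Xi> (r(a := Suc i)) c) d = coeff (indexed_minor k \<Psi> (r(a := Suc i)) c) d"
    proof (rule expand_col)
      fix b assume b: "b < k" "c b = Suc i"
      show "coeff (indexed_minor k \<Psi> (r(a := Suc i)) (c(b := i))) d = 0"
      proof (cases "i \<in> c ` {..<k}")
        case True
        then obtain b' where "b' < k" "c b' = i" by auto
        then have "indexed_minor k \<Psi> (r(a := Suc i)) (c(b := i)) = 0"
          using b by (intro indexed_minor_repeated_col[of b _ b']) auto
        then show ?thesis by simp
      next
        case False
        show ?thesis
          unfolding \<Psi>_f[OF disjI1, OF row]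
          by (rule top_coeff_indexed_minor_zero[OF f_diag supp])
            (auto intro: admissible_double_move[OF a new b False])
      qed
    qed
    also have "\<dots> = 0"
      unfolding \<Psi>_f[OF disjI1, OF row]
      by (rule top_coeff_indexed_minor_zero[OF f_diag supp]) (auto intro: down[OF a new])
    finally show ?thesis .
  qed
  have left0: "coeff (indexed_minor k \<Psi> r (c(b := i))) d = 0" if b: "b < k" "c b = Suc i" for b
  proof (cases "i \<in> c ` {..<k}")
    case True
    then obtain b' where "b' < k" "c b' = i" by auto
    then have "indexed_minor k \<Psi> r (c(b := i)) = 0"
      using b by (intro indexed_minor_repeated_col[of b _ b']) auto
    then show ?thesis by simp
  next
    case False
    have col: "\<forall>b'<k. (c(b := i)) b' \<noteq> Suc i"
    proof (intro allI impI)
      fix b' assume "b' < k"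
      then show "(c(b := i)) b' \<noteq> Suc i" using inj_onD[OF inj_c, of b' b] b by (cases "b' = b") auto
    qed
    show ?thesis
      unfolding \<Psi>_f[OF disjI2, OF col]
      by (rule top_coeff_indexed_minor_zero[OF f_diag supp]) (auto intro: left[OF b False])
  qed
  \<comment> \<open>A Leibniz term through the extra entry contributes to \<open>\<lambda>\<^sup>d\<close> neither in \<open>\<Psi>\<close> nor in the matrix without it.\<close>
  have uses: "off_weight k h r c \<pi> = 0 \<or> card (diag_hits k r c \<pi>) < d" "off_weight k f r c \<pi> = 0"
    if \<pi>: "\<pi> permutes {0..<k}" and a: "a < k" "r a = i" "c (\<pi> a) = Suc i" for \<pi> a
  proof -
    have h_supp: "(p, q) \<in> insert (i, Suc i) Q" if "h p q \<noteq> 0" for p q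
      using that supp by (auto simp: h_def split: if_splits)
    show "off_weight k h r c \<pi> = 0 \<or> card (diag_hits k r c \<pi>) < d"
      using admissible_at_superdiagonal[where \<pi> = \<pi>, OF _ a]
        admissible_if_off_weight[where f = h and r = r and c = c, OF \<pi> _ h_supp] by blast
    show "off_weight k f r c \<pi> = 0"
      unfolding off_weight_def using a f0[of i "Suc i"]
      by (intro prod_zero) (auto simp: diag_hits_def intro!: bexI[of _ a])
  qed
  have same: "off_weight k h r c \<pi> = off_weight k f r c \<pi>"
    if "\<nexists>a. a < k \<and> r a = i \<and> c (\<pi> a) = Suc i" for \<pi>
    using that by (intro off_weight_cong) (auto simp: h_def)
  have f_bound: "card (diag_hits k r c \<pi>) \<le> d"
    if "\<pi> permutes {0..<k}" "off_weight k f r c \<pi> \<noteq> 0" for \<pi>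
    using admissible_if_off_weight[OF that supp] top by blast
  have h_bound: "card (diag_hits k r c \<pi>) \<le> d"
    if \<pi>: "\<pi> permutes {0..<k}" "off_weight k h r c \<pi> \<noteq> 0" for \<pi>
    using uses(1)[OF \<pi>(1)] same[of \<pi>] f_bound[OF \<pi>(1)] \<pi>(2) less_imp_le by metis
  have fh: "off_weight k h r c \<pi> = off_weight k f r c \<pi>"
    if "\<pi> permutes {0..<k}" "card (diag_hits k r c \<pi>) = d" for \<pi>
    using uses[OF that(1)] same[of \<pi>] that(2) by (metis less_irrefl)
  have "shifted_char f' (\<lambda>_. 0) = (\<lambda>p q. \<Xi> p q + (if p = i then [:t:] * \<Xi> (Suc i) q else 0))"
    by (intro ext) (rule entrywise)
  then have "coeff (indexed_minor k (shifted_char f' (\<lambda>_. 0)) r c) d =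
      coeff (indexed_minor k (\<lambda>p q. \<Xi> p q + (if p = i then [:t:] * \<Xi> (Suc i) q else 0)) r c) d"
    by (rule arg_cong)
  also have "\<dots> = coeff (indexed_minor k \<Xi> r c) d"
  proof (cases "i \<in> r ` {..<k}")
    case True
    then obtain a where a: "a < k" "r a = i" by auto
    show ?thesis
      unfolding indexed_minor_add_row[OF inj_r a] using down0[OF a] by simp
  next
    case False
    then have "r a \<noteq> i" if "a < k" for a using that by (metis imageI lessThan_iff)
    then show ?thesis
      by (intro arg_cong[where f = "\<lambda>p. coeff p d"] indexed_minor_cong) simp
  qed
  also have "\<dots> = coeff (indexed_minor k \<Psi> r c) d"
    by (rule expand_col) (rule left0)
  also have "\<dots> = coeff (indexed_minor k (shifted_char f (\<lambda>_. 0)) r c) d"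
    unfolding \<Psi>_def
    by (subst (1 2) top_coeff_indexed_minor[OF _ ])
      (auto simp: h_diag f_diag fh intro: f_bound h_bound intro!: sum.cong)
  finally show ?thesis .
qed
end

section \<open>Minors of the formal matrix\<close>

text \<open>The rows of a submatrix are listed by \<open>pick\<close>. Recognising any increasing enumeration as this one
  lets the rows of a moved minor be written as an update of the original ones.\<close>

lemma pick_enumeration:
  assumes "strict_mono_on {..<k} r" "a < k"
  shows "pick (r ` {..<k}) a = r a"
proof -
  have "{x \<in> r ` {..<k}. x < r a} = r ` {..<a}"
    using assms by (auto simp: strict_mono_on_less)
  moreover have "inj_on r {..<a}"
    using strict_mono_on_imp_inj_on[OF assms(1)] assms(2) by (auto intro: inj_on_subset)
  ultimately have "card {x \<in> r ` {..<k}. x < r a} = a" by (simp add: card_image)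
  then show ?thesis using pick_card_in_set[of "r a" "r ` {..<k}"] assms(2) by auto
qed

lemma char_minor_eq_indexed_minor:
  assumes A: "A \<in> carrier_mat n n"
    and r: "strict_mono_on {..<k} r" "r ` {..<k} = I" "I \<subseteq> {..<n}"
    and c: "strict_mono_on {..<k} c" "c ` {..<k} = J" "J \<subseteq> {..<n}"
  shows "char_minor A I J = indexed_minor k (shifted_char (\<lambda>p q. A $$ (p, q)) (\<lambda>_. 0)) r c"
proof -
  have card: "card {x. x < n \<and> x \<in> s ` {..<k}} = k"
    if "strict_mono_on {..<k} s" "s ` {..<k} \<subseteq> {..<n}" for s :: "nat \<Rightarrow> nat"
  proof -
    have "{x. x < n \<and> x \<in> s ` {..<k}} = s ` {..<k}" using that by auto
    then show ?thesis using strict_mono_on_imp_inj_on[OF that(1)] by (simp add: card_image)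
  qed
  have rn: "r a < n" if "a < k" for a using that r by auto
  have cn: "c a < n" if "a < k" for a using that c by auto
  have dim: "dim_row (char_matrix A) = n" "dim_col (char_matrix A) = n"
    using A by (auto simp: char_matrix_def)
  have "submatrix (char_matrix A) I J = mat k k (\<lambda>(a, b). shifted_char (\<lambda>p q. A $$ (p, q)) (\<lambda>_. 0) (r a) (c b))"
  proof (rule eq_matI)
    fix a b
    assume "a < dim_row (mat k k (\<lambda>(a, b). shifted_char (\<lambda>p q. A $$ (p, q)) (\<lambda>_. 0) (r a) (c b)))"
      and "b < dim_col (mat k k (\<lambda>(a, b). shifted_char (\<lambda>p q. A $$ (p, q)) (\<lambda>_. 0) (r a) (c b)))"
    then have ab: "a < k" "b < k" by auto
    have "submatrix (char_matrix A) I J $$ (a, b) = char_matrix A $$ (r a, c b)"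
      using card[of r] card[of c] r c ab pick_enumeration[OF r(1) ab(1)] pick_enumeration[OF c(1) ab(2)]
      by (subst submatrix_index) (auto simp: dim)
    also have "\<dots> = shifted_char (\<lambda>p q. A $$ (p, q)) (\<lambda>_. 0) (r a) (c b)"
      using A rn[OF ab(1)] cn[OF ab(2)] by (auto simp: char_matrix_def shifted_char_def one_pCons)
    finally show "submatrix (char_matrix A) I J $$ (a, b) =
        mat k k (\<lambda>(a, b). shifted_char (\<lambda>p q. A $$ (p, q)) (\<lambda>_. 0) (r a) (c b)) $$ (a, b)"
      using ab by simp
  qed (use card[of r] card[of c] r c in \<open>simp_all add: dim_submatrix dim\<close>)
  then show ?thesis by (simp add: char_minor_def indexed_minor_def)
qed

lemma strict_mono_on_pick:
  assumes "finite I"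
  shows "strict_mono_on {..<card I} (pick I)" "pick I ` {..<card I} = I"
proof -
  show mono: "strict_mono_on {..<card I} (pick I)"
    by (auto simp: strict_mono_on_def intro: pick_mono_le)
  have "pick I ` {..<card I} \<subseteq> I" using pick_in_set_le by auto
  moreover have "card (pick I ` {..<card I}) = card I"
    using strict_mono_on_imp_inj_on[OF mono] by (simp add: card_image)
  ultimately show "pick I ` {..<card I} = I" using assms by (intro card_subset_eq)
qed

lemma strict_mono_on_raise:
  fixes r :: "nat \<Rightarrow> nat"
  assumes "strict_mono_on {..<k} r" and a: "a < k" "r a = i" and new: "Suc i \<notin> r ` {..<k}"
  shows "strict_mono_on {..<k} (r(a := Suc i))"
    "(r(a := Suc i)) ` {..<k} = (r ` {..<k} - {i}) \<union> {i + 1}"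
proof -
  have ne: "r x \<noteq> Suc i" if "x < k" for x using new that by (metis imageI lessThan_iff)
  have mono: "r x < r y \<longleftrightarrow> x < y" if "x < k" "y < k" for x y
    using strict_mono_on_less[OF assms(1)] that by simp
  have "(r(a := Suc i)) x < (r(a := Suc i)) y" if "x < y" "x < k" "y < k" for x y
    using mono[OF that(2,3)] that a ne[OF that(3)] by (auto simp: less_Suc_eq_le Suc_lessI)
  then show "strict_mono_on {..<k} (r(a := Suc i))" by (auto simp: strict_mono_on_def)
  have inj: "r x = i \<longleftrightarrow> x = a" if "x < k" for x
    using inj_onD[OF strict_mono_on_imp_inj_on[OF assms(1)], of x a] that a by auto
  show "(r(a := Suc i)) ` {..<k} = (r ` {..<k} - {i}) \<union> {i + 1}"
    using a inj by (auto simp: image_iff)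
qed

lemma strict_mono_on_lower:
  fixes c :: "nat \<Rightarrow> nat"
  assumes "strict_mono_on {..<k} c" and b: "b < k" "c b = Suc i" and new: "i \<notin> c ` {..<k}"
  shows "strict_mono_on {..<k} (c(b := i))"
    "(c(b := i)) ` {..<k} = (c ` {..<k} - {i + 1}) \<union> {i}"
proof -
  have ne: "c x \<noteq> i" if "x < k" for x using new that by (metis imageI lessThan_iff)
  have mono: "c x < c y \<longleftrightarrow> x < y" if "x < k" "y < k" for x y
    using strict_mono_on_less[OF assms(1)] that by simp
  have "(c(b := i)) x < (c(b := i)) y" if "x < y" "x < k" "y < k" for x y
    using mono[OF that(2,3)] that b ne[OF that(2)] by (auto simp: less_Suc_eq)
  then show "strict_mono_on {..<k} (c(b := i))" by (auto simp: strict_mono_on_def)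
  have inj: "c x = Suc i \<longleftrightarrow> x = b" if "x < k" for x
    using inj_onD[OF strict_mono_on_imp_inj_on[OF assms(1)], of x b] that b by auto
  show "(c(b := i)) ` {..<k} = (c ` {..<k} - {i + 1}) \<union> {i}"
    using b inj by (auto simp: image_iff)
qed

lemma root_set_regular:
  assumes "regular_subset n M"
  shows "root_set (pos_roots n - M)"
proof
  fix p q i
  show "q < p" if "(p, q) \<in> pos_roots n - M" using that by (simp add: pos_roots_def)
  show "(p, Suc i) \<in> pos_roots n - M" if "(p, i) \<in> pos_roots n - M" "Suc i < p"
  proof -
    have "(p, Suc i) \<in> pos_roots n" "(Suc i, i) \<in> pos_roots n" using that by (auto simp: pos_roots_def)
    then show ?thesis using assms that unfolding regular_subset_def by blast
  qed
  show "(i, q) \<in> pos_roots n - M" if "(Suc i, q) \<in> pos_roots n - M" "q < i"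
  proof -
    have "(Suc i, i) \<in> pos_roots n" "(i, q) \<in> pos_roots n" using that by (auto simp: pos_roots_def)
    then show ?thesis using assms that unfolding regular_subset_def by blast
  qed
qed

lemma generic_minor_eq:
  assumes "strict_mono_on {..<k} r" "r ` {..<k} = I" "I \<subseteq> {..<n}"
    and "strict_mono_on {..<k} c" "c ` {..<k} = J" "J \<subseteq> {..<n}"
  shows "char_minor (Phi n M) I J =
    indexed_minor k (shifted_char (generic_entry (pos_roots n - M)) (\<lambda>_. 0)) r c"
proof -
  have Phi: "Phi n M \<in> carrier_mat n n" by (simp add: Phi_def)
  have "r a < n" "c a < n" if "a < k" for a using that assms by blast+
  then show ?thesis
    unfolding char_minor_eq_indexed_minor[OF Phi assms]
    by (intro indexed_minor_cong) (simp add: shifted_char_def generic_entry_def Phi_def)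
qed

text \<open>An admissible bijection with \<open>e\<close> diagonal places makes its minor nonzero of degree at least \<open>e\<close>.
  So the bounds on degrees in the definition of extremality are bounds on bijections.\<close>

lemma extremal_position_if_extremal:
  assumes M: "regular_subset n M"
    and r: "strict_mono_on {..<k} r" "r ` {..<k} = I" "I \<subseteq> {..<n}"
    and c: "strict_mono_on {..<k} c" "c ` {..<k} = J" "J \<subseteq> {..<n}"
    and ext: "extremal (Phi n M :: 'a::field_char_0 pair_poly mat) I J"
    and i: "Suc i < n"
  shows "extremal_position (pos_roots n - M) k r c (degree (char_minor (Phi n M :: 'a pair_poly mat) I J)) i"
proof -
  let ?Phi = "Phi n M :: 'a pair_poly mat"
  let ?Q = "pos_roots n - M"
  have hits: "char_minor ?Phi I' J' \<noteq> 0 \<and> card (diag_hits k r' c' \<pi>) \<le> degree (char_minor ?Phi I' J')"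
    if "admissible ?Q k r' c' \<pi>"
      and r': "strict_mono_on {..<k} r'" "r' ` {..<k} = I'" "I' \<subseteq> {..<n}"
      and c': "strict_mono_on {..<k} c'" "c' ` {..<k} = J'" "J' \<subseteq> {..<n}" for r' c' I' J' \<pi>
  proof -
    have "coeff (char_minor ?Phi I' J') (card (diag_hits k r' c' \<pi>)) \<noteq> 0"
      unfolding generic_minor_eq[OF r' c']
      by (rule generic_minor_coeff_nonzero)
        (use that in \<open>auto simp: pos_roots_def intro: strict_mono_on_imp_inj_on\<close>)
    then show ?thesis using le_degree by auto
  qed
  have dim: "dim_row ?Phi = n" by (simp add: Phi_def)
  interpret root_set ?Q by (rule root_set_regular[OF M])
  show ?thesis
  proof
    show "inj_on r {..<k}" "inj_on c {..<k}"
      using r c by (auto intro: strict_mono_on_imp_inj_on)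
    show "card (diag_hits k r c \<pi>) \<le> degree (char_minor ?Phi I J)" if "admissible ?Q k r c \<pi>" for \<pi>
      using hits[OF that r c] by simp
    show "card (diag_hits k (r(a := Suc i)) c \<pi>) < degree (char_minor ?Phi I J)"
      if a: "a < k" "r a = i" and new: "Suc i \<notin> r ` {..<k}"
        and adm: "admissible ?Q k (r(a := Suc i)) c \<pi>" for a \<pi>
    proof -
      have "char_minor ?Phi ((I - {i}) \<union> {i + 1}) J \<noteq> 0 \<and>
          card (diag_hits k (r(a := Suc i)) c \<pi>) \<le> degree (char_minor ?Phi ((I - {i}) \<union> {i + 1}) J)"
        by (rule hits[OF adm _ _ _ c]) (use strict_mono_on_raise[OF r(1) a new] r i in auto)
      moreover have "char_minor_down ?Phi I J i = char_minor ?Phi ((I - {i}) \<union> {i + 1}) J"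
        using a new r(2) by (auto simp: char_minor_down_def)
      ultimately show ?thesis using ext i unfolding extremal_def dim by fastforce
    qed
    show "card (diag_hits k r (c(b := i)) \<pi>) < degree (char_minor ?Phi I J)"
      if b: "b < k" "c b = Suc i" and new: "i \<notin> c ` {..<k}"
        and adm: "admissible ?Q k r (c(b := i)) \<pi>" for b \<pi>
    proof -
      have "char_minor ?Phi I ((J - {i + 1}) \<union> {i}) \<noteq> 0 \<and>
          card (diag_hits k r (c(b := i)) \<pi>) \<le> degree (char_minor ?Phi I ((J - {i + 1}) \<union> {i}))"
        by (rule hits[OF adm r]) (use strict_mono_on_lower[OF c(1) b new] c i in auto)
      moreover have "char_minor_left ?Phi I J i = char_minor ?Phi I ((J - {i + 1}) \<union> {i})"
      proof -
        have "Suc i \<in> c ` {..<k}" using b by (metis imageI lessThan_iff)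
        then show ?thesis using new c(2) by (simp add: char_minor_left_def)
      qed
      ultimately show ?thesis using ext i unfolding extremal_def dim by fastforce
    qed
  qed
qed

section \<open>The adjoint action on the symmetric algebra\<close>

lemma factor_coset_eqI:
  assumes X: "X \<in> carrier_mat n n" and Y: "Y \<in> carrier_mat n n"
    and eq: "\<And>i j. i < n \<Longrightarrow> j < n \<Longrightarrow> (i, j) \<notin> M \<Longrightarrow> X $$ (i, j) = Y $$ (i, j)"
  shows "factor_coset n M X = factor_coset n M Y"
proof -
  have sub: "factor_coset n M A \<subseteq> factor_coset n M B"
    if A: "A \<in> carrier_mat n n" and B: "B \<in> carrier_mat n n"
      and AB: "\<And>i j. i < n \<Longrightarrow> j < n \<Longrightarrow> (i, j) \<notin> M \<Longrightarrow> A $$ (i, j) = B $$ (i, j)" for A B :: "'a mat"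
  proof
    fix W assume "W \<in> factor_coset n M A"
    then obtain Z where Z: "Z \<in> reg_ideal n M" "W = A + Z" unfolding factor_coset_def by blast
    have "W = B + (A - B + Z)" using A B Z by (intro eq_matI) (auto simp: reg_ideal_iff)
    moreover have "A - B + Z \<in> reg_ideal n M" using A B AB Z by (auto simp: reg_ideal_iff)
    ultimately show "W \<in> factor_coset n M B" unfolding factor_coset_def by blast
  qed
  show ?thesis using sub[OF X Y eq] sub[OF Y X eq[symmetric]] by blast
qed

lemma finite_pos_roots: "finite (pos_roots n)"
  by (rule finite_subset[of _ "{..<n} \<times> {..<n}"]) (auto simp: pos_roots_def)

lemma matrix_unit_nil_alg: "\<eta> \<in> pos_roots n \<Longrightarrow> matrix_unit n \<eta> \<in> nil_alg n"
  by (auto simp: matrix_unit_def nil_alg_def pos_roots_def)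

lemma nil_alg_add:
  assumes "X \<in> nil_alg n" "Y \<in> nil_alg n"
  shows "X + Y \<in> nil_alg n"
  using assms by (auto simp: nil_alg_def dest: carrier_matD)

lemma nil_alg_smult:
  assumes "X \<in> nil_alg n"
  shows "c \<cdot>\<^sub>m X \<in> nil_alg n"
proof -
  have "X \<in> carrier_mat n n" using assms by (simp add: nil_alg_def)
  then have "c \<cdot>\<^sub>m X \<in> carrier_mat n n" "dim_row X = n" "dim_col X = n" by auto
  then show ?thesis using assms by (simp add: nil_alg_def)
qed

text \<open>A linear map on the factor algebra is determined by its values on the basis of matrix units. The homomorphism
  \<open>\<iota>\<close> provides the scalars of the target, so that the lemma covers functionals as well as maps into the
  symmetric algebra.\<close>

lemma linear_on_factor_alg:
  fixes \<phi> :: "'a::field_char_0 mat set \<Rightarrow> 'b::comm_ring_1"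
  assumes M: "M \<subseteq> pos_roots n" and \<iota>: "comm_ring_hom \<iota>"
    and add: "\<And>X Y. X \<in> nil_alg n \<Longrightarrow> Y \<in> nil_alg n \<Longrightarrow>
      \<phi> (factor_coset n M (X + Y)) = \<phi> (factor_coset n M X) + \<phi> (factor_coset n M Y)"
    and smult: "\<And>X c. X \<in> nil_alg n \<Longrightarrow> \<phi> (factor_coset n M (c \<cdot>\<^sub>m X)) = \<iota> c * \<phi> (factor_coset n M X)"
    and X: "X \<in> nil_alg n"
  shows "\<phi> (factor_coset n M X) =
    (\<Sum>\<eta>\<in>pos_roots n - M. \<iota> (X $$ \<eta>) * \<phi> (factor_coset n M (matrix_unit n \<eta>)))"
proof -
  interpret comm_ring_hom \<iota> by fact
  define part where "part A = mat n n (\<lambda>\<eta>. if \<eta> \<in> A then X $$ \<eta> else 0)" for A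
  have nil: "part A \<in> nil_alg n" if "A \<subseteq> pos_roots n" for A
    using that by (auto simp: part_def nil_alg_def pos_roots_def)
  have expand: "\<phi> (factor_coset n M (part A)) =
      (\<Sum>\<eta>\<in>A. \<iota> (X $$ \<eta>) * \<phi> (factor_coset n M (matrix_unit n \<eta>)))"
    if "finite A" "A \<subseteq> pos_roots n" for A
    using that
  proof (induction A rule: finite_induct)
    case empty
    have zero: "part {} \<in> nil_alg n" by (rule nil) simp
    have "part {} = 0 \<cdot>\<^sub>m part {}" by (intro eq_matI) (auto simp: part_def)
    then show ?case using smult[OF zero, of 0] by simp
  next
    case (insert \<eta> A)
    have \<eta>: "matrix_unit n \<eta> \<in> nil_alg n" using insert by (intro matrix_unit_nil_alg) simp
    then have c\<eta>: "X $$ \<eta> \<cdot>\<^sub>m matrix_unit n \<eta> \<in> nil_alg n" by (rule nil_alg_smult)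
    have "part (insert \<eta> A) = X $$ \<eta> \<cdot>\<^sub>m matrix_unit n \<eta> + part A"
      using insert by (intro eq_matI) (auto simp: part_def matrix_unit_def)
    then show ?case
      using insert add[OF c\<eta> nil[of A]] smult[OF \<eta>] by simp
  qed
  have "finite (pos_roots n)" by (rule finite_pos_roots)
  moreover have "factor_coset n M X = factor_coset n M (part (pos_roots n - M))"
    using X by (intro factor_coset_eqI) (auto simp: part_def nil_alg_def pos_roots_def)
  ultimately show ?thesis using expand[of "pos_roots n - M"] by auto
qed

lemma UT_inv: "g \<in> carrier (UT n) \<Longrightarrow> inv\<^bsub>UT n\<^esub> g \<in> carrier (UT n)"
  by (rule group.inv_closed[OF group_UT])

lemma UT_carrier_mat: "g \<in> carrier (UT n) \<Longrightarrow> g \<in> carrier_mat n n"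
  by (simp add: carrier_UT)

lemma nil_alg_carrier_mat: "X \<in> nil_alg n \<Longrightarrow> X \<in> carrier_mat n n"
  by (simp add: nil_alg_def)

lemma factor_coset_conj_linear:
  assumes M: "regular_subset n M" and g: "g \<in> carrier (UT n)"
    and X: "X \<in> nil_alg n" and Y: "Y \<in> nil_alg n"
  defines "cj \<equiv> \<lambda>X. g * X * inv\<^bsub>UT n\<^esub> g"
  shows "Ad n g (factor_coset n M (X + Y)) = factor_coset n M (cj X + cj Y)"
    and "Ad n g (factor_coset n M (c \<cdot>\<^sub>m X)) = factor_coset n M (c \<cdot>\<^sub>m cj X)"
proof -
  note car = UT_carrier_mat[OF g] UT_carrier_mat[OF UT_inv[OF g]] nil_alg_carrier_mat[OF X]
    nil_alg_carrier_mat[OF Y]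
  have "X + Y \<in> nil_alg n" using X Y by (rule nil_alg_add)
  moreover have "cj (X + Y) = cj X + cj Y"
    using car by (simp add: cj_def mult_add_distrib_mat[of _ n n _ n] add_mult_distrib_mat[of _ n n _ _ n])
  ultimately show "Ad n g (factor_coset n M (X + Y)) = factor_coset n M (cj X + cj Y)"
    by (simp add: Ad_factor_coset[OF M g] cj_def)
  have "c \<cdot>\<^sub>m X \<in> nil_alg n" using X by (rule nil_alg_smult)
  moreover have "cj (c \<cdot>\<^sub>m X) = c \<cdot>\<^sub>m cj X"
    using car by (simp add: cj_def mult_smult_distrib[of _ n n _ n] mult_smult_assoc_mat[of _ n n _ n])
  ultimately show "Ad n g (factor_coset n M (c \<cdot>\<^sub>m X)) = factor_coset n M (c \<cdot>\<^sub>m cj X)"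
    by (simp add: Ad_factor_coset[OF M g] cj_def)
qed

lemma Sym_emb_add:
  assumes "X \<in> carrier_mat n n" "Y \<in> carrier_mat n n"
  shows "Sym_emb n M (factor_coset n M (X + Y)) =
    Sym_emb n M (factor_coset n M X) + Sym_emb n M (factor_coset n M Y)"
proof -
  interpret comm_ring_hom Const by (rule comm_ring_hom_Const)
  have "(X + Y) $$ \<eta> = X $$ \<eta> + Y $$ \<eta>" if "\<eta> \<in> pos_roots n - M" for \<eta>
    using that assms by (cases \<eta>) (auto simp: pos_roots_def)
  then show ?thesis
    using assms by (simp add: Sym_emb_factor_coset hom_add distrib_right sum.distrib)
qed

lemma Sym_emb_smult:
  assumes "X \<in> carrier_mat n n"
  shows "Sym_emb n M (factor_coset n M (c \<cdot>\<^sub>m X)) = Const c * Sym_emb n M (factor_coset n M X)"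
proof -
  interpret comm_ring_hom Const by (rule comm_ring_hom_Const)
  have "(c \<cdot>\<^sub>m X) $$ \<eta> = c * X $$ \<eta>" if "\<eta> \<in> pos_roots n - M" for \<eta>
    using that assms by (cases \<eta>) (auto simp: pos_roots_def)
  then show ?thesis
    using assms by (simp add: Sym_emb_factor_coset hom_mult sum_distrib_left mult.assoc)
qed

text \<open>The algebra endomorphism extends the adjoint action on the whole factor algebra, not only on the
  matrix units by which it is given: both sides are linear and agree there.\<close>

lemma Ad_Sym_emb:
  fixes g :: "'a::field_char_0 mat"
  assumes M: "regular_subset n M" and g: "g \<in> carrier (UT n)" and X: "X \<in> nil_alg n"
  shows "Ad_Sym n M g (Sym_emb n M (factor_coset n M X)) = Sym_emb n M (Ad n g (factor_coset n M X))"
proof -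
  interpret comm_ring_hom "Ad_Sym n M g"
    unfolding Ad_Sym_def by (rule comm_ring_hom_evaluate[OF comm_ring_hom_Const])
  note car = nil_alg_carrier_mat[OF conj_nil_alg[OF g]]
  have "Ad_Sym n M g (Sym_emb n M (factor_coset n M X)) =
      (\<Sum>\<eta>\<in>pos_roots n - M. Const (X $$ \<eta>) * Sym_emb n M (Ad n g (factor_coset n M (matrix_unit n \<eta>))))"
    unfolding Sym_emb_factor_coset[OF nil_alg_carrier_mat[OF X]]
    by (simp add: hom_sum hom_mult)
      (simp add: Ad_Sym_def evaluate_Const[OF comm_ring_hom_Const] evaluate_Var[OF comm_ring_hom_Const])
  also have "\<dots> = Sym_emb n M (Ad n g (factor_coset n M X))"
  proof (rule linear_on_factor_alg[OF _ comm_ring_hom_Const _ _ X, symmetric])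
    show "M \<subseteq> pos_roots n" using M by (simp add: regular_subset_def)
  next
    fix X Y :: "'a mat" assume XY: "X \<in> nil_alg n" "Y \<in> nil_alg n"
    show "Sym_emb n M (Ad n g (factor_coset n M (X + Y))) =
        Sym_emb n M (Ad n g (factor_coset n M X)) + Sym_emb n M (Ad n g (factor_coset n M Y))"
      unfolding factor_coset_conj_linear(1)[OF M g XY] Ad_factor_coset[OF M g XY(1)] Ad_factor_coset[OF M g XY(2)]
      using car[OF XY(1)] car[OF XY(2)]
      by (rule Sym_emb_add)
  next
    fix X :: "'a mat" and c assume X: "X \<in> nil_alg n"
    show "Sym_emb n M (Ad n g (factor_coset n M (c \<cdot>\<^sub>m X))) =
        Const c * Sym_emb n M (Ad n g (factor_coset n M X))"
      unfolding factor_coset_conj_linear(2)[OF M g X X] Ad_factor_coset[OF M g X]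
      using car[OF X]
      by (rule Sym_emb_smult)
  qed
  finally show ?thesis .
qed

lemma Ad_Sym_mult:
  fixes g :: "'a::field_char_0 mat"
  assumes M: "regular_subset n M" and g: "g \<in> carrier (UT n)" and h: "h \<in> carrier (UT n)"
    and p: "p \<in> Sym_alg n M"
  shows "Ad_Sym n M (g * h) p = Ad_Sym n M g (Ad_Sym n M h p)"
proof -
  interpret comm_ring_hom "Ad_Sym n M g"
    unfolding Ad_Sym_def by (rule comm_ring_hom_evaluate[OF comm_ring_hom_Const])
  have gh: "g * h \<in> carrier (UT n)"
    using monoid.m_closed[OF group.is_monoid[OF group_UT] g h] by simp
  have inv_gh: "inv\<^bsub>UT n\<^esub> (g * h) = inv\<^bsub>UT n\<^esub> h * inv\<^bsub>UT n\<^esub> g"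
    using group.inv_mult_group[OF group_UT g h] by simp
  note car = UT_carrier_mat[OF g] UT_carrier_mat[OF h] UT_carrier_mat[OF UT_inv[OF g]]
    UT_carrier_mat[OF UT_inv[OF h]]
  have "Ad n (g * h) (factor_coset n M X) = Ad n g (Ad n h (factor_coset n M X))"
    if X: "X \<in> nil_alg n" for X
    using car X nil_alg_carrier_mat[OF X] conj_nil_alg[OF h X]
    by (simp add: Ad_factor_coset[OF M] g h gh inv_gh assoc_mult_mat[of _ n n _ n _ n])
  moreover have "Ad_Sym n M g (Sym_emb n M (Ad n h (factor_coset n M X))) =
      Sym_emb n M (Ad n g (Ad n h (factor_coset n M X)))" if X: "X \<in> nil_alg n" for X
    unfolding Ad_factor_coset[OF M h X] by (rule Ad_Sym_emb[OF M g conj_nil_alg[OF h X]])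
  ultimately have "Sym_emb n M (Ad n (g * h) (factor_coset n M (matrix_unit n \<eta>))) =
      Ad_Sym n M g (Sym_emb n M (Ad n h (factor_coset n M (matrix_unit n \<eta>))))"
    if "\<eta> \<in> pos_roots n - M" for \<eta>
    using that matrix_unit_nil_alg[of \<eta> n, where 'a = 'a] by simp
  then have "Ad_Sym n M (g * h) p =
      evaluate Const (\<lambda>\<eta>. Ad_Sym n M g (Sym_emb n M (Ad n h (factor_coset n M (matrix_unit n \<eta>))))) p"
    unfolding Ad_Sym_def[of n M "g * h"] by (rule evaluate_cong_Sym_alg[OF p])
  also have "\<dots> = Ad_Sym n M g (Ad_Sym n M h p)"
    unfolding Ad_Sym_def[of n M h] comp_evaluate[OF comm_ring_hom_axioms]
    by (simp add: Ad_Sym_def evaluate_Const[OF comm_ring_hom_Const])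
  finally show ?thesis .
qed

lemma Sym_emb_Ad_matrix_unit:
  fixes g :: "'a::field_char_0 mat"
  assumes M: "regular_subset n M" and g: "g \<in> carrier (UT n)" and pq: "(p, q) \<in> pos_roots n"
  shows "Sym_emb n M (Ad n g (factor_coset n M (matrix_unit n (p, q)))) =
    (\<Sum>(a, b)\<in>pos_roots n - M. Const (g $$ (a, p) * (inv\<^bsub>UT n\<^esub> g) $$ (q, b)) * Var (a, b))"
proof -
  let ?h = "inv\<^bsub>UT n\<^esub> g"
  have c: "g \<in> carrier_mat n n" "?h \<in> carrier_mat n n" "(matrix_unit n (p, q) :: 'a mat) \<in> carrier_mat n n"
    using UT_carrier_mat[OF g] UT_carrier_mat[OF UT_inv[OF g]] by (auto simp: matrix_unit_def)
  have pqn: "p < n" "q < n" using pq by (auto simp: pos_roots_def)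
  let ?E = "matrix_unit n (p, q) :: 'a mat"
  have gE: "g * ?E \<in> carrier_mat n n" by (rule mult_carrier_mat[OF c(1,3)])
  have left: "(g * ?E) $$ (a, k) = (if k = q then g $$ (a, p) else 0)" if "a < n" "k < n" for a k
  proof -
    have "(g * ?E) $$ (a, k) = (\<Sum>l<n. g $$ (a, l) * ?E $$ (l, k))"
      by (rule index_mult_sum[OF c(1,3) that])
    also have "\<dots> = (\<Sum>l<n. if l = p then (if k = q then g $$ (a, p) else 0) else 0)"
      by (intro sum.cong) (use that in \<open>auto simp: matrix_unit_def\<close>)
    finally show ?thesis using pqn by simp
  qed
  have "(g * ?E * ?h) $$ (a, b) = g $$ (a, p) * ?h $$ (q, b)" if "a < n" "b < n" for a b
  proof -
    have "(g * ?E * ?h) $$ (a, b) = (\<Sum>k<n. (g * ?E) $$ (a, k) * ?h $$ (k, b))"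
      by (rule index_mult_sum[OF gE c(2) that])
    also have "\<dots> = (\<Sum>k<n. if k = q then g $$ (a, p) * ?h $$ (q, b) else 0)"
      by (intro sum.cong refl) (simp add: left that del: index_mult_mat(1))
    finally show ?thesis using pqn by simp
  qed
  then show ?thesis
    using mult_carrier_mat[OF gE c(2)] matrix_unit_nil_alg[OF pq, where 'a = 'a]
    by (auto simp: Ad_factor_coset[OF M g] Sym_emb_factor_coset pos_roots_def simp del: index_mult_mat(1) intro!: sum.cong)
qed

text \<open>For \<open>g = E + t E\<^bsub>i+1,i\<^esub>\<close> and its inverse \<open>h\<close>, the sum of all
  \<open>g\<^bsub>a,p\<^esub> h\<^bsub>q,b\<^esub> y\<^bsub>a,b\<^esub>\<close> has at most two nonzero terms: a third one, with coefficient \<open>- t\<^sup>2\<close>, would require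
  \<open>p = i\<close> and \<open>q = i + 1\<close>, which is above the diagonal.\<close>

lemma Sym_emb_Ad_simple:
  fixes t :: "'a::field_char_0"
  assumes M: "regular_subset n M" and i: "Suc i < n" and pq: "(p, q) \<in> pos_roots n - M"
  defines "F \<equiv> generic_entry (pos_roots n - M)"
  shows "Sym_emb n M (Ad n (addrow_mat n t (Suc i) i) (factor_coset n M (matrix_unit n (p, q)))) =
    F p q + (if p = i then Const t * F (Suc i) q else 0) - (if q = Suc i then Const t * F p i else 0)"
proof -
  let ?x = "addrow_mat n t (Suc i) i" and ?y = "addrow_mat n (- t) (Suc i) i"
  let ?Q = "pos_roots n - M"
  interpret comm_ring_hom "Const :: 'a \<Rightarrow> _" by (rule comm_ring_hom_Const)
  have x: "?x \<in> carrier (UT n)" and y: "?y \<in> carrier (UT n)" using i by (auto simp: carrier_UT)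
  have "?y * ?x = 1\<^sub>m n" using addrow_mat_inv[of "Suc i" n i "- t"] i by simp
  then have inv: "inv\<^bsub>UT n\<^esub> ?x = ?y" using group.inv_equality[OF group_UT _ x y] by simp
  have pqn: "q < p" "p < n" "q < n" using pq by (auto simp: pos_roots_def)
  have summand: "Const (?x $$ (a, p) * ?y $$ (q, b)) * Var (a, b) =
      (if (a, b) = (p, q) then Var (p, q) else 0)
      + (if (a, b) = (Suc i, q) then (if p = i then Const t * Var (Suc i, q) else 0) else 0)
      - (if (a, b) = (p, i) then (if q = Suc i then Const t * Var (p, i) else 0) else 0)"
    if "a < n" "b < n" for a b
    using that pqn i by (auto simp: hom_mult hom_uminus)
  have fin: "finite ?Q" by (simp add: finite_pos_roots)
  have "Sym_emb n M (Ad n ?x (factor_coset n M (matrix_unit n (p, q)))) =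
      (\<Sum>\<zeta>\<in>?Q. (if \<zeta> = (p, q) then Var (p, q) else 0)
      + (if \<zeta> = (Suc i, q) then (if p = i then Const t * Var (Suc i, q) else 0) else 0)
      - (if \<zeta> = (p, i) then (if q = Suc i then Const t * Var (p, i) else 0) else 0))"
    unfolding Sym_emb_Ad_matrix_unit[OF M x DiffD1[OF pq]] inv
  proof (rule sum.cong[OF refl])
    fix \<zeta> assume "\<zeta> \<in> ?Q"
    then obtain a b where "\<zeta> = (a, b)" "a < n" "b < n" by (cases \<zeta>) (auto simp: pos_roots_def)
    then show "(case \<zeta> of (a, b) \<Rightarrow> Const (?x $$ (a, p) * ?y $$ (q, b)) * Var (a, b)) =
      (if \<zeta> = (p, q) then Var (p, q) else 0)
      + (if \<zeta> = (Suc i, q) then (if p = i then Const t * Var (Suc i, q) else 0) else 0)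
      - (if \<zeta> = (p, i) then (if q = Suc i then Const t * Var (p, i) else 0) else 0)"
      using summand[of a b] by simp
  qed
  also have "\<dots> = F p q + (if p = i then Const t * F (Suc i) q else 0) - (if q = Suc i then Const t * F p i else 0)"
    unfolding sum.distrib sum_subtractf using fin by (simp add: F_def generic_entry_def)
  finally show ?thesis .
qed

lemma Sym_emb_Ad_one:
  assumes M: "regular_subset n M" and \<eta>: "\<eta> \<in> pos_roots n - M"
  shows "Sym_emb n M (Ad n (1\<^sub>m n) (factor_coset n M (matrix_unit n \<eta> :: 'a::field_char_0 mat))) = Var \<eta>"
proof -
  let ?E = "matrix_unit n \<eta> :: 'a mat"
  have one: "1\<^sub>m n \<in> carrier (UT n :: 'a mat monoid)" by (simp add: carrier_UT)
  have inv: "inv\<^bsub>UT n\<^esub> 1\<^sub>m n = (1\<^sub>m n :: 'a mat)"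
    using monoid.inv_one[OF group.is_monoid[OF group_UT]] by (metis one_UT)
  have E: "?E \<in> nil_alg n" "?E \<in> carrier_mat n n"
    using \<eta> by (auto intro: matrix_unit_nil_alg nil_alg_carrier_mat)
  have "Ad n (1\<^sub>m n) (factor_coset n M ?E) = factor_coset n M ?E"
    unfolding Ad_factor_coset[OF M one E(1)] inv using E(2) by simp
  moreover have "(\<Sum>\<zeta>\<in>pos_roots n - M. Const (?E $$ \<zeta>) * Var \<zeta>) =
      (\<Sum>\<zeta>\<in>pos_roots n - M. if \<zeta> = \<eta> then Var \<eta> else 0)"
    by (intro sum.cong refl) (auto simp: matrix_unit_def pos_roots_def Const_def)
  ultimately show ?thesis
    using \<eta> by (simp add: Sym_emb_factor_coset[OF E(2)] finite_pos_roots)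
qed

lemma comm_ring_hom_map_poly:
  assumes "comm_ring_hom H"
  shows "comm_ring_hom (map_poly H)"
proof -
  interpret comm_ring_hom H by fact
  have coeff: "coeff (map_poly H p) e = H (coeff p e)" for p e by (simp add: coeff_map_poly)
  show ?thesis
    by standard (auto intro!: poly_eqI simp: coeff coeff_mult hom_add hom_mult hom_sum map_poly_1')
qed

text \<open>The action on a coefficient of a characteristic minor is computed entrywise, since coefficients and
  determinants commute with ring homomorphisms.\<close>

lemma hom_coeff_indexed_minor:
  assumes "comm_ring_hom H"
  shows "H (coeff (indexed_minor k (shifted_char f (\<lambda>_. 0)) r c) d) =
    coeff (indexed_minor k (shifted_char (\<lambda>p q. H (f p q)) (\<lambda>_. 0)) r c) d"
proof -
  interpret comm_ring_hom H by fact
  interpret P: comm_ring_hom "map_poly H" by (rule comm_ring_hom_map_poly) fact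
  have "map_poly H (shifted_char f (\<lambda>_. 0) p q) = shifted_char (\<lambda>p q. H (f p q)) (\<lambda>_. 0) p q" for p q
    by (simp add: shifted_char_def P.hom_minus map_poly_pCons)
  then have "map_mat (map_poly H) (mat k k (\<lambda>(a, b). shifted_char f (\<lambda>_. 0) (r a) (c b))) =
      mat k k (\<lambda>(a, b). shifted_char (\<lambda>p q. H (f p q)) (\<lambda>_. 0) (r a) (c b))"
    by (intro eq_matI) auto
  then have "map_poly H (indexed_minor k (shifted_char f (\<lambda>_. 0)) r c) =
      indexed_minor k (shifted_char (\<lambda>p q. H (f p q)) (\<lambda>_. 0)) r c"
    unfolding indexed_minor_def by (metis P.hom_det)
  then show ?thesis by (metis coeff_map_poly hom_zero)
qed

lemma coeff_indexed_minor_Sym_alg: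
  fixes f :: "nat \<Rightarrow> nat \<Rightarrow> 'a::field_char_0 pair_poly"
  assumes f: "\<And>p q. f p q \<in> Sym_alg n M"
  shows "coeff (indexed_minor k (shifted_char f (\<lambda>_. 0)) r c) d \<in> Sym_alg n M"
proof -
  have mult: "\<forall>e. coeff (u * v) e \<in> Sym_alg n M"
    if "\<forall>e. coeff u e \<in> Sym_alg n M" "\<forall>e. coeff v e \<in> Sym_alg n M" for u v :: "'a pair_poly poly"
    using that by (auto simp: coeff_mult intro!: Sym_alg_sum Sym_alg_mult)
  have entry: "\<forall>e. coeff (shifted_char f (\<lambda>_. 0) p q) e \<in> Sym_alg n M" for p q
    using f Sym_alg_add[OF f Sym_alg_uminus[OF Sym_alg_1]]
    by (auto simp: shifted_char_def coeff_pCons Sym_alg_0 Sym_alg_1 Sym_alg_uminus split: nat.split)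
  have prod: "\<forall>e. coeff (\<Prod>a\<in>A. shifted_char f (\<lambda>_. 0) (r a) (c (\<pi> a))) e \<in> Sym_alg n M" for A \<pi>
  proof (induction A rule: infinite_finite_induct)
    case (insert x F)
    then show ?case using mult[OF entry] by simp
  qed (auto simp: Sym_alg_0 Sym_alg_1)
  show ?thesis
    unfolding coeff_indexed_minor using prod
    by (auto simp: sign_def intro!: Sym_alg_sum Sym_alg_uminus)
qed

section \<open>The coadjoint action on regular functions\<close>

lemma coAd_dual:
  assumes M: "regular_subset n M" and g: "g \<in> carrier (UT n)" and f: "f \<in> dual n M"
  shows "coAd n M (inv\<^bsub>UT n\<^esub> g) f \<in> dual n M"
    and "X \<in> nil_alg n \<Longrightarrow> coAd n M (inv\<^bsub>UT n\<^esub> g) f (factor_coset n M X) = f (Ad n g (factor_coset n M X))"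
proof -
  have val: "coAd n M (inv\<^bsub>UT n\<^esub> g) f (factor_coset n M X) = f (Ad n g (factor_coset n M X))"
    if "X \<in> nil_alg n" for X
    using that by (simp add: coAd_def factor_alg_def group.inv_inv[OF group_UT g])
  then show "X \<in> nil_alg n \<Longrightarrow> coAd n M (inv\<^bsub>UT n\<^esub> g) f (factor_coset n M X) = f (Ad n g (factor_coset n M X))" .
  show "coAd n M (inv\<^bsub>UT n\<^esub> g) f \<in> dual n M"
    unfolding dual_def
  proof (intro CollectI conjI ballI allI)
    show "coAd n M (inv\<^bsub>UT n\<^esub> g) f \<in> extensional (factor_alg n M)" by (simp add: coAd_def)
  next
    fix X Y :: "'a mat" and c assume XY: "X \<in> nil_alg n" "Y \<in> nil_alg n"
    note conj = conj_nil_alg[OF g XY(1)] conj_nil_alg[OF g XY(2)]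
    show "coAd n M (inv\<^bsub>UT n\<^esub> g) f (factor_coset n M (X + Y)) =
        coAd n M (inv\<^bsub>UT n\<^esub> g) f (factor_coset n M X) + coAd n M (inv\<^bsub>UT n\<^esub> g) f (factor_coset n M Y)"
      unfolding val[OF XY(1)] val[OF XY(2)] val[OF nil_alg_add[OF XY]]
        factor_coset_conj_linear(1)[OF M g XY] Ad_factor_coset[OF M g XY(1)] Ad_factor_coset[OF M g XY(2)]
      using f conj unfolding dual_def by blast
    show "coAd n M (inv\<^bsub>UT n\<^esub> g) f (factor_coset n M (c \<cdot>\<^sub>m X)) =
        c * coAd n M (inv\<^bsub>UT n\<^esub> g) f (factor_coset n M X)"
      unfolding val[OF XY(1)] val[OF nil_alg_smult[OF XY(1)]]
        factor_coset_conj_linear(2)[OF M g XY(1) XY(1)] Ad_factor_coset[OF M g XY(1)]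
      using f conj unfolding dual_def by blast
  qed
qed

text \<open>Evaluating a polynomial at a functional is a ring homomorphism that restricts to the functional itself on
  the factor algebra. Moving the functional by \<open>g\<close> inverse is therefore the same as acting on
  the variables by \<open>g\<close>.\<close>

lemma regular_fun_coAd:
  fixes g :: "'a::field_char_0 mat"
  assumes M: "regular_subset n M" and g: "g \<in> carrier (UT n)" and f: "f \<in> dual n M"
    and p: "p \<in> Sym_alg n M"
  shows "regular_fun n M p (coAd n M (inv\<^bsub>UT n\<^esub> g) f) = regular_fun n M (Ad_Sym n M g p) f"
proof -
  let ?v = "\<lambda>\<eta>. f (factor_coset n M (matrix_unit n \<eta>))"
  let ?ev = "evaluate (\<lambda>c. c) ?v"
  note hom = comm_ring_hom_id[where 'a = 'a]
  interpret comm_ring_hom ?ev by (rule comm_ring_hom_evaluate[OF hom])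
  have ev: "?ev (Sym_emb n M (factor_coset n M X)) = f (factor_coset n M X)" if X: "X \<in> nil_alg n" for X
  proof -
    have "f (factor_coset n M X) = (\<Sum>\<eta>\<in>pos_roots n - M. X $$ \<eta> * ?v \<eta>)"
    proof (rule linear_on_factor_alg[OF _ hom _ _ X])
      show "M \<subseteq> pos_roots n" using M by (simp add: regular_subset_def)
    qed (use f in \<open>auto simp: dual_def\<close>)
    then show ?thesis
      using nil_alg_carrier_mat[OF X]
      by (simp add: Sym_emb_factor_coset hom_sum hom_mult evaluate_Const[OF hom] evaluate_Var[OF hom])
  qed
  have unit: "coAd n M (inv\<^bsub>UT n\<^esub> g) f (factor_coset n M (matrix_unit n \<eta>)) =
      ?ev (Sym_emb n M (Ad n g (factor_coset n M (matrix_unit n \<eta>))))" if "\<eta> \<in> pos_roots n - M" for \<eta>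
  proof -
    have u: "matrix_unit n \<eta> \<in> nil_alg n" using that by (intro matrix_unit_nil_alg) simp
    show ?thesis
      unfolding coAd_dual(2)[OF M g f u] Ad_factor_coset[OF M g u] by (rule ev[OF conj_nil_alg[OF g u], symmetric])
  qed
  have "regular_fun n M p (coAd n M (inv\<^bsub>UT n\<^esub> g) f) =
      evaluate (\<lambda>c. c) (\<lambda>\<eta>. coAd n M (inv\<^bsub>UT n\<^esub> g) f (factor_coset n M (matrix_unit n \<eta>))) p"
    using coAd_dual(1)[OF M g f] by (simp add: regular_fun_def)
  also have "\<dots> = evaluate (\<lambda>c. c) (\<lambda>\<eta>. ?ev (Sym_emb n M (Ad n g (factor_coset n M (matrix_unit n \<eta>))))) p"
    by (rule evaluate_cong_Sym_alg[OF p unit])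
  also have "\<dots> = ?ev (Ad_Sym n M g p)"
    unfolding Ad_Sym_def comp_evaluate[OF comm_ring_hom_axioms] by (simp add: evaluate_Const[OF hom])
  finally show ?thesis using f by (simp add: regular_fun_def)
qed

lemma regular_invariants_if_Sym_invariants:
  assumes M: "regular_subset n M" and p: "p \<in> Sym_invariants n M"
  shows "regular_fun n M p \<in> regular_invariants n M"
proof -
  have "coAd_fun n M g (regular_fun n M p) = regular_fun n M p" if g: "g \<in> carrier (UT n)" for g
  proof
    fix f
    show "coAd_fun n M g (regular_fun n M p) f = regular_fun n M p f"
    proof (cases "f \<in> dual n M")
      case True
      then show ?thesis
        using regular_fun_coAd[OF M g True, of p] p g by (simp add: coAd_fun_def Sym_invariants_def)
    next
      case False
      then show ?thesis by (simp add: coAd_fun_def regular_fun_def)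
    qed
  qed
  then show ?thesis using p by (auto simp: regular_invariants_def Sym_invariants_def)
qed

section \<open>Invariance of the highest coefficient\<close>

theorem theorem2p5:
  fixes n :: nat and M :: "(nat \<times> nat) set" and I J :: "nat set"
    and P :: "'a::field_char_0 pair_poly"
  assumes "regular_subset n M"
    and "I \<subseteq> {..<n}" and "J \<subseteq> {..<n}" and "card I = card J"
    and "extremal (Phi n M :: 'a pair_poly mat) I J"
    and "P = lead_coeff (char_minor (Phi n M) I J)"
  shows "P \<in> Sym_invariants n M \<and> regular_fun n M P \<in> regular_invariants n M"
proof -
  note M = assms(1)
  define k where "k = card I"
  define d where "d = degree (char_minor (Phi n M :: 'a pair_poly mat) I J)"
  let ?Q = "pos_roots n - M"
  let ?F = "generic_entry ?Q :: nat \<Rightarrow> nat \<Rightarrow> 'a pair_poly"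
  let ?minor = "\<lambda>f :: nat \<Rightarrow> nat \<Rightarrow> 'a pair_poly. indexed_minor k (shifted_char f (\<lambda>_. 0)) (pick I) (pick J)"
  have fin: "finite I" "finite J" using assms(2,3) finite_subset by auto
  have r: "strict_mono_on {..<k} (pick I)" "pick I ` {..<k} = I"
    using strict_mono_on_pick[OF fin(1)] by (simp_all add: k_def)
  have c: "strict_mono_on {..<k} (pick J)" "pick J ` {..<k} = J"
    using strict_mono_on_pick[OF fin(2)] by (simp_all add: k_def assms(4))
  have P: "P = coeff (?minor ?F) d"
    unfolding assms(6) d_def generic_minor_eq[OF r assms(2) c assms(3)] ..
  have P_Sym: "P \<in> Sym_alg n M"
    unfolding P by (rule coeff_indexed_minor_Sym_alg) (simp add: generic_entry_def Sym_alg_0 Sym_alg_Var)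
  have act: "Ad_Sym n M g P = coeff (?minor (\<lambda>p q. Ad_Sym n M g (?F p q))) d" for g
    unfolding P Ad_Sym_def
    by (rule hom_coeff_indexed_minor) (rule comm_ring_hom_evaluate[OF comm_ring_hom_Const])
  have entry: "Ad_Sym n M g (?F p q) =
      (if (p, q) \<in> ?Q then Sym_emb n M (Ad n g (factor_coset n M (matrix_unit n (p, q)))) else 0)" for g p q
    by (simp add: evaluate_Var[OF comm_ring_hom_Const] Ad_Sym_def generic_entry_def evaluate_def[of _ _ 0])
  have invariant_simple: "Ad_Sym n M (addrow_mat n t (Suc i) i) P = P" if i: "Suc i < n" for t i
  proof -
    interpret extremal_position ?Q k "pick I" "pick J" d i
      unfolding d_def by (rule extremal_position_if_extremal[OF M r assms(2) c assms(3,5) i])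
    have new_entry: "Ad_Sym n M (addrow_mat n t (Suc i) i) (?F p q) = (if (p, q) \<in> ?Q
        then ?F p q + (if p = i then Const t * ?F (Suc i) q else 0) - (if q = Suc i then Const t * ?F p i else 0) else 0)"
      for p q
      unfolding entry by (simp only: Sym_emb_Ad_simple[OF M i] cong: if_cong)
    show ?thesis
      unfolding act new_entry unfolding P
      by (rule top_coeff_simple_conjugation[OF generic_entry_support])
  qed
  have "Ad_Sym n M g P = P" if "g \<in> carrier (UT n)" for g
    using that
  proof (induction g rule: UT_simple_induct)
    case one
    have "Ad_Sym n M (1\<^sub>m n) (?F p q) = ?F p q" for p q
    proof (cases "(p, q) \<in> ?Q")
      case True
      then show ?thesis
        unfolding entry using Sym_emb_Ad_one[OF M True, where 'a = 'a] by (simp add: generic_entry_def)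
    next
      case False
      then show ?thesis unfolding entry by (auto simp: generic_entry_def)
    qed
    then show ?case unfolding act by (simp only: P)
  next
    case (simple g t i)
    have x: "addrow_mat n t (Suc i) i \<in> carrier (UT n)" using \<open>Suc i < n\<close> by (auto simp: carrier_UT)
    have "addrow t (Suc i) i g = addrow_mat n t (Suc i) i * g"
      using \<open>g \<in> carrier (UT n)\<close> \<open>Suc i < n\<close> by (intro addrow_mat) (auto simp: carrier_UT)
    then show ?case
      using Ad_Sym_mult[OF M x \<open>g \<in> carrier (UT n)\<close> P_Sym] \<open>Ad_Sym n M g P = P\<close>
        invariant_simple[OF \<open>Suc i < n\<close>]
      by simp
  qed
  then have "P \<in> Sym_invariants n M" using P_Sym by (simp add: Sym_invariants_def)
  then show ?thesis using regular_invariants_if_Sym_invariants[OF M] by blast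
qed

end
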